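(* Let $T\ge1$, and let $\varepsilon=0$ under convention E and $\varepsilon=1$ under convention N. The learner has access only to the weak consistency oracle. (Upper bound) There is a deterministic learner that, on every instance, makes at most $66T$ calls and at most $\lfloor\log_2(T+1)\rfloor$ mistakes under E, and at most $67(T-1)$ calls and at most $\lfloor\log_2T\rfloor$ mistakes under N. (Lower bound) Conversely, suppose $T-\varepsilon\ge100$. Any learner, deterministic or randomized, that makes at most $(T-\varepsilon)/20$ calls on every run incurs at least $(T-\varepsilon)/20$ expected mistakes on some instance; and any learner with worst-instance expected mistakes $m$ and worst-instance expected calls $q$ satisfies $$m+20q\ \ge\ \frac{T-\varepsilon}{20}.$$ Hence, at this interface, $\Theta(T)$ calls are necessary and sufficient for $O(\log T)$ mistakes, for both deterministic and randomized learners.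
   Context: Domain and conventions. $T$ distinct instances are announced in advance as a sequence $x_1,\dots,x_T$. Convention E: $X=\{s,x_1,\dots,x_T\}$ and only total orders on $X$ in which the sentinel $s$ is the minimum are admissible. Convention N: $X=\{x_1,\dots,x_T\}$, all total orders on $X$ are admissible. For a total order $\preceq$ on $X$ and $z\in X$ let $c_z(x)=\mathbf 1[x\preceq z]$ and $C_\preceq=\{c_z:z\in X\}$. Weak consistency oracle. On a sample $S\subseteq X\times\{0,1\}$ it returns only the bit telling whether some $c\in C_\preceq$ satisfies $c(x)=y$ for all $(x,y)\in S$. Protocol. The learner knows the convention, $X$, $T$ and the sequence, but not $\preceq$ or $z$. In round $t$ it predicts $\hat y_t\in\{0,1\}$ and then sees $y_t=c_z(x_t)$; at any time it may call the oracle on any adaptively chosen sample, each call costing one regardless of $|S|$. An instance is a pair ($\preceq$, $z$) fixed before the learner's private randomness; "worst-instance expected" means the supremum over instances of the expectation over that randomness. *)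

theory Defs
  imports "HOL-Probability.Probability"
begin

text \<open>
  Labels 0 and 1 are \<^const>\<open>False\<close> and \<^const>\<open>True\<close>. The announced sequence is a list \<open>xs\<close>,
  with \<open>T = length xs\<close>; list positions start at 0, so the instance of round \<open>t\<close> is \<open>xs ! (t - 1)\<close>.
  Convention E carries its sentinel.
\<close>

datatype 'a convention = Conv_E 'a | Conv_N

fun eps :: "'a convention \<Rightarrow> real" where
  "eps (Conv_E s) = 0"
| "eps Conv_N = 1"

fun points :: "'a convention \<Rightarrow> 'a list \<Rightarrow> 'a set" where
  "points (Conv_E s) xs = insert s (set xs)"
| "points Conv_N xs = set xs"

fun setting :: "'a convention \<Rightarrow> 'a list \<Rightarrow> bool" where
  "setting (Conv_E s) xs \<longleftrightarrow> length xs \<ge> 1 \<and> distinct xs \<and> s \<notin> set xs"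
| "setting Conv_N xs \<longleftrightarrow> length xs \<ge> 1 \<and> distinct xs"

text \<open>A pair \<open>(x, y) \<in> r\<close> reads \<open>x \<preceq> y\<close> (the non-strict order).\<close>

fun admissible :: "'a convention \<Rightarrow> 'a list \<Rightarrow> 'a rel \<Rightarrow> bool" where
  "admissible (Conv_E s) xs r \<longleftrightarrow>
     linear_order_on (points (Conv_E s) xs) r \<and> (\<forall>x \<in> points (Conv_E s) xs. (s, x) \<in> r)"
| "admissible Conv_N xs r \<longleftrightarrow> linear_order_on (points Conv_N xs) r"

definition instances :: "'a convention \<Rightarrow> 'a list \<Rightarrow> ('a rel \<times> 'a) set" where
  "instances c xs = {(r, z). admissible c xs r \<and> z \<in> points c xs}"

definition threshold :: "'a rel \<Rightarrow> 'a \<Rightarrow> 'a \<Rightarrow> bool" where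
  "threshold r z x \<longleftrightarrow> (x, z) \<in> r"

definition concepts :: "'a set \<Rightarrow> 'a rel \<Rightarrow> ('a \<Rightarrow> bool) set" where
  "concepts X r = threshold r ` X"

type_synonym 'a sample = "('a \<times> bool) set"

definition weak_oracle :: "('a \<Rightarrow> bool) set \<Rightarrow> 'a sample \<Rightarrow> bool" where
  "weak_oracle C S \<longleftrightarrow> (\<exists>h\<in>C. \<forall>(x, y)\<in>S. h x = y)"

text \<open>
  A step of the interaction is an oracle call, answered by the oracle's bit, or a prediction for the
  current round, answered by the true label. A deterministic learner chooses the next step from the
  chronological transcript of all previous steps and answers; it may depend on the convention and
  on the announced sequence because these are fixed before the learner is chosen.
\<close>

datatype 'a action = Call "'a sample" | Predict bool

type_synonym 'a transcript = "('a action \<times> bool) list"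
type_synonym 'a learner = "'a transcript \<Rightarrow> 'a action"

definition legal_learner :: "'a convention \<Rightarrow> 'a list \<Rightarrow> 'a learner \<Rightarrow> bool" where
  "legal_learner c xs L \<longleftrightarrow> (\<forall>tr S. L tr = Call S \<longrightarrow> S \<subseteq> points c xs \<times> UNIV)"

fun is_call :: "'a action \<times> bool \<Rightarrow> bool" where
  "is_call (Call S, b) \<longleftrightarrow> True"
| "is_call (Predict p, b) \<longleftrightarrow> False"

fun is_mistake :: "'a action \<times> bool \<Rightarrow> bool" where
  "is_mistake (Call S, b) \<longleftrightarrow> False"
| "is_mistake (Predict p, b) \<longleftrightarrow> p \<noteq> b"

definition rounds_done :: "'a transcript \<Rightarrow> nat" where
  "rounds_done tr = length (filter (\<lambda>e. \<not> is_call e) tr)"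

fun answer :: "'a convention \<Rightarrow> 'a list \<Rightarrow> 'a rel \<times> 'a \<Rightarrow> 'a transcript \<Rightarrow> 'a action \<Rightarrow> bool" where
  "answer c xs (r, z) tr (Call S) = weak_oracle (concepts (points c xs) r) S"
| "answer c xs (r, z) tr (Predict p) = threshold r z (xs ! rounds_done tr)"

text \<open>
  The transcript after \<open>n\<close> steps. It stops growing once all \<open>T\<close> labels have been revealed, since
  calls after the last round cannot influence the number of mistakes.
\<close>

primrec transcript ::
  "'a convention \<Rightarrow> 'a list \<Rightarrow> 'a learner \<Rightarrow> 'a rel \<times> 'a \<Rightarrow> nat \<Rightarrow> 'a transcript" where
  "transcript c xs L i 0 = []"
| "transcript c xs L i (Suc n) =
     (let tr = transcript c xs L i n in
      if rounds_done tr < length xs then tr @ [(L tr, answer c xs i tr (L tr))] else tr)"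

text \<open>
  A learner that keeps calling the oracle without ever completing the rounds makes
  infinitely many calls, so a finite bound on \<open>calls\<close> forces all \<open>T\<close> predictions to be made.
\<close>

definition calls :: "'a convention \<Rightarrow> 'a list \<Rightarrow> 'a learner \<Rightarrow> 'a rel \<times> 'a \<Rightarrow> enat" where
  "calls c xs L i = (SUP n. enat (length (filter is_call (transcript c xs L i n))))"

definition mistakes :: "'a convention \<Rightarrow> 'a list \<Rightarrow> 'a learner \<Rightarrow> 'a rel \<times> 'a \<Rightarrow> enat" where
  "mistakes c xs L i = (SUP n. enat (length (filter is_mistake (transcript c xs L i n))))"

text \<open>
  A randomized learner draws its private randomness \<open>\<omega>\<close> from an arbitrary probability space \<open>M\<close>,
  independently of the instance, and then plays the deterministic learner \<open>L \<omega>\<close>. Deterministic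
  learners are the case of a constant \<open>L\<close>.
\<close>

definition randomized_learner ::
  "'a convention \<Rightarrow> 'a list \<Rightarrow> 'w measure \<Rightarrow> ('w \<Rightarrow> 'a learner) \<Rightarrow> bool" where
  "randomized_learner c xs M L \<longleftrightarrow>
     prob_space M \<and>
     (\<forall>tr. (\<lambda>\<omega>. L \<omega> tr) \<in> M \<rightarrow>\<^sub>M count_space UNIV) \<and>
     (\<forall>\<omega>\<in>space M. legal_learner c xs (L \<omega>))"

definition expected_calls ::
  "'a convention \<Rightarrow> 'a list \<Rightarrow> 'w measure \<Rightarrow> ('w \<Rightarrow> 'a learner) \<Rightarrow> 'a rel \<times> 'a \<Rightarrow> ennreal" where
  "expected_calls c xs M L i = (\<integral>\<^sup>+ \<omega>. ennreal_of_enat (calls c xs (L \<omega>) i) \<partial>M)"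

definition expected_mistakes ::
  "'a convention \<Rightarrow> 'a list \<Rightarrow> 'w measure \<Rightarrow> ('w \<Rightarrow> 'a learner) \<Rightarrow> 'a rel \<times> 'a \<Rightarrow> ennreal" where
  "expected_mistakes c xs M L i = (\<integral>\<^sup>+ \<omega>. ennreal_of_enat (mistakes c xs (L \<omega>) i) \<partial>M)"

definition worst_expected_calls ::
  "'a convention \<Rightarrow> 'a list \<Rightarrow> 'w measure \<Rightarrow> ('w \<Rightarrow> 'a learner) \<Rightarrow> ennreal" where
  "worst_expected_calls c xs M L = (SUP i\<in>instances c xs. expected_calls c xs M L i)"

definition worst_expected_mistakes ::
  "'a convention \<Rightarrow> 'a list \<Rightarrow> 'w measure \<Rightarrow> ('w \<Rightarrow> 'a learner) \<Rightarrow> ennreal" where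
  "worst_expected_mistakes c xs M L = (SUP i\<in>instances c xs. expected_mistakes c xs M L i)"

definition worst_calls :: "'a convention \<Rightarrow> 'a list \<Rightarrow> 'a learner \<Rightarrow> ennreal" where
  "worst_calls c xs L = (SUP i\<in>instances c xs. ennreal_of_enat (calls c xs L i))"

definition worst_mistakes :: "'a convention \<Rightarrow> 'a list \<Rightarrow> 'a learner \<Rightarrow> ennreal" where
  "worst_mistakes c xs L = (SUP i\<in>instances c xs. ennreal_of_enat (mistakes c xs L i))"

end

theory Submission
  imports Defs
begin

text \<open>
  Upper bound: the sample \<open>{(a, 1), (b, 0)}\<close> is consistent iff \<open>a\<close> lies strictly below \<open>b\<close>, so the oracle
  simulates comparisons. The learner keeps an order interval of \<open>N\<close> candidates for \<open>z\<close>, computes its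
  median with at most \<open>33 (N - 1)\<close> comparisons by the median-of-medians algorithm, and predicts with the
  median as threshold until it errs; each mistake halves the interval, so the calls form a geometric
  series bounded by \<open>66 (N - 1)\<close>.

  Lower bound: every label vector that is 1 on the first instance is realised by some order and \<open>z\<close>.
  The answers of the calls and the positions of the mistakes determine the transcript and hence the
  labels, so the \<open>2\<^bsup>T-1\<^esup>\<close> label vectors have distinct codes. Weighting calls and mistakes by \<open>1/2\<close>
  gives a Kraft inequality, which forces calls plus mistakes to be at least \<open>T div 5\<close> on average over these vectors.
\<close>

text \<open>Knowledge is the set of instances compatible with the answers so far, and no order is
  ever constructed. Calls depend on the order alone, so only labels can locate \<open>z\<close>. The
  constant 33 solves the selection recurrence: the block medians cost about \<open>2 n\<close> calls
  and the comparisons with the pivot \<open>n\<close>, while the recursions act on about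
  \<open>n / 5\<close> and \<open>7 n / 10\<close> elements. A factor \<open>C\<close> therefore
  needs \<open>3 + 0.9 C <= C\<close>, that is \<open>C >= 30\<close> up to rounding. In the lower
  bound, the oracle enters only through the fact that a call returns one bit determined by the
  instance. The obstacle is that the positions of the mistakes carry information too:
  \<open>k\<close> mistakes can be placed in \<open>T\<close> rounds in \<open>T choose k\<close>
  ways, so a bound \<open>2 ^ cost\<close> on the number of codes is false. Letting each correct
  prediction cost a factor 2/3 pays for the positions: all rounds together account for a factor
  \<open>(3/2) ^ T\<close>, which falls short of \<open>2 ^ (T - 1)\<close> by at least
  \<open>2 ^ (T div 5)\<close>.\<close>

definition query :: "'a convention \<Rightarrow> 'a list \<Rightarrow> 'a rel \<times> 'a \<Rightarrow> 'a sample \<Rightarrow> bool" where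
  "query c xs i S = weak_oracle (concepts (points c xs) (fst i)) S"

lemma answer_Call [simp]: "answer c xs i tr (Call S) = query c xs i S"
  by (cases i) (simp add: query_def)

definition label :: "'a rel \<times> 'a \<Rightarrow> 'a \<Rightarrow> bool" where
  "label i x = threshold (fst i) (snd i) x"

lemma answer_Predict [simp]: "answer c xs i tr (Predict p) = label i (xs ! rounds_done tr)"
  by (cases i) (simp add: label_def)

declare answer.simps [simp del]

lemma instances_linear_order:
  assumes "I \<subseteq> instances c xs" "i \<in> I"
  shows "linear_order_on (points c xs) (fst i)"
  using assms by (cases c) (auto simp: instances_def)

lemma finite_points [simp]: "finite (points c xs)"
  by (cases c) auto

lemma finite_subset_points: "A \<subseteq> points c xs \<Longrightarrow> finite A"
  using finite_subset finite_points by blast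

lemma set_subset_points: "set xs \<subseteq> points c xs"
  by (cases c) auto

section \<open>Query trees\<close>

text \<open>On total orders the failure of the reverse relation is strict comparison, and it is
  exactly the bit that the oracle returns. For empty \<open>I\<close> all pairs satisfy it.\<close>

definition below :: "('a rel \<times> 'a) set \<Rightarrow> 'a \<Rightarrow> 'a \<Rightarrow> bool" where
  "below I a b \<longleftrightarrow> (\<forall>i\<in>I. (b, a) \<notin> fst i)"

lemma below_mono: "below I a b \<Longrightarrow> J \<subseteq> I \<Longrightarrow> below J a b"
  by (auto simp: below_def)

lemma linear_order_cases:
  assumes "linear_order_on X r" "a \<in> X" "b \<in> X"
  shows "(b, a) \<notin> r \<longleftrightarrow> (a, b) \<in> r \<and> a \<noteq> b"
  using assms
  unfolding linear_order_on_def partial_order_on_def preorder_on_def refl_on_def total_on_def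
    antisym_def
  by metis

lemma linear_order_trans:
  "linear_order_on X r \<Longrightarrow> (a, b) \<in> r \<Longrightarrow> (b, c) \<in> r \<Longrightarrow> (a, c) \<in> r"
  unfolding linear_order_on_def partial_order_on_def preorder_on_def
  by (metis transD)

lemma linear_order_refl: "linear_order_on X r \<Longrightarrow> a \<in> X \<Longrightarrow> (a, a) \<in> r"
  unfolding linear_order_on_def partial_order_on_def preorder_on_def
  by (metis refl_onD)

lemma below_trans:
  assumes I: "I \<subseteq> instances c xs" and ab: "below I a b" and bd: "below I b d"
    and X: "a \<in> points c xs" "b \<in> points c xs" "d \<in> points c xs"
  shows "below I a d"
  unfolding below_def
proof
  fix i assume i: "i \<in> I"
  note lin = instances_linear_order[OF I i]
  show "(d, a) \<notin> fst i"
    using ab bd i X lin linear_order_cases[OF lin] linear_order_trans[OF lin]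
    unfolding below_def by metis
qed

text \<open>If \<open>b\<close> does not precede \<open>a\<close>, the threshold at \<open>a\<close>
  itself fits the sample; otherwise any threshold that accepts \<open>a\<close> accepts
  \<open>b\<close> by transitivity.\<close>

lemma weak_oracle_pair:
  assumes lin: "linear_order_on X r" and ab: "a \<in> X" "b \<in> X"
  shows "weak_oracle (concepts X r) {(a, True), (b, False)} \<longleftrightarrow> (b, a) \<notin> r"
  using ab linear_order_refl[OF lin] linear_order_trans[OF lin]
  by (auto simp: weak_oracle_def concepts_def threshold_def)

text \<open>
  Query algorithms are represented by the sets of instances still compatible with the answers:
  \<open>reach c xs I q P\<close> says that starting from the knowledge \<open>I\<close>, at most \<open>q\<close> adaptive calls lead to
  knowledge satisfying \<open>P\<close>, whatever the answers. A property may hold vacuously of empty knowledge.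
\<close>

inductive reach ::
  "'a convention \<Rightarrow> 'a list \<Rightarrow> ('a rel \<times> 'a) set \<Rightarrow> nat \<Rightarrow> (('a rel \<times> 'a) set \<Rightarrow> bool) \<Rightarrow> bool"
  for c xs where
  stop: "P I \<Longrightarrow> reach c xs I q P"
| ask: "S \<subseteq> points c xs \<times> UNIV \<Longrightarrow> reach c xs {i \<in> I. query c xs i S} q P \<Longrightarrow>
    reach c xs {i \<in> I. \<not> query c xs i S} q P \<Longrightarrow> reach c xs I (Suc q) P"

lemma reach_mono: "reach c xs I q P \<Longrightarrow> q \<le> q' \<Longrightarrow> reach c xs I q' P"
proof (induction arbitrary: q' rule: reach.induct)
  case (ask S I q P)
  then show ?case by (cases q') (auto intro: reach.ask)
qed (rule reach.stop)

text \<open>\<open>P\<close> may hide a result existentially, such as a median that differs from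
  leaf to leaf. The continuation is therefore chosen anew for each final knowledge
  \<open>J\<close>.\<close>

lemma reach_bind:
  assumes "reach c xs I q P" and "\<And>J. J \<subseteq> I \<Longrightarrow> P J \<Longrightarrow> reach c xs J q' Q"
  shows "reach c xs I (q + q') Q"
  using assms
proof (induction rule: reach.induct)
  case (stop P I q)
  show ?case by (rule reach_mono[OF stop(2)]) (use stop in auto)
next
  case (ask S I q P)
  have "reach c xs I (Suc (q + q')) Q"
  proof (rule reach.ask[OF ask.hyps(1)])
    show "reach c xs {i \<in> I. query c xs i S} (q + q') Q"
      by (rule ask.IH(1)) (use ask.prems in blast)
    show "reach c xs {i \<in> I. \<not> query c xs i S} (q + q') Q"
      by (rule ask.IH(2)) (use ask.prems in blast)
  qed
  then show ?case by simp
qed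

lemma reach_conseq:
  assumes "reach c xs I q P" and "\<And>J. J \<subseteq> I \<Longrightarrow> P J \<Longrightarrow> Q J"
  shows "reach c xs I q Q"
  using reach_bind[OF assms(1), of 0 Q] assms(2) by (auto intro: reach.stop)

lemma reach_compare:
  assumes I: "I \<subseteq> instances c xs" and X: "a \<in> points c xs" "b \<in> points c xs" "a \<noteq> b"
  shows "reach c xs I 1 (\<lambda>J. below J a b \<or> below J b a)"
proof -
  let ?S = "{(a, True), (b, False)}"
  have S: "query c xs i ?S \<longleftrightarrow> (b, a) \<notin> fst i" if "i \<in> I" for i
    using weak_oracle_pair[OF instances_linear_order[OF I that] X(1,2)] by (simp add: query_def)
  have "below {i \<in> I. query c xs i ?S} a b"
    by (auto simp: below_def S)
  moreover have "below {i \<in> I. \<not> query c xs i ?S} b a"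
    using linear_order_cases[OF instances_linear_order[OF I] X(2,1)] X(3)
    by (auto simp: below_def S)
  ultimately show ?thesis
    unfolding One_nat_def using X by (intro reach.ask[of ?S] reach.stop) auto
qed

text \<open>Disjointness is stated explicitly because empty knowledge makes all \<open>below\<close>
  facts vacuous, while the cardinality counts must survive.\<close>

definition pivot ::
  "('a rel \<times> 'a) set \<Rightarrow> 'a set \<Rightarrow> 'a \<Rightarrow> 'a set \<Rightarrow> 'a set \<Rightarrow> bool" where
  "pivot I A p L G \<longleftrightarrow> A = insert p (L \<union> G) \<and> p \<notin> L \<union> G \<and> L \<inter> G = {} \<and>
     (\<forall>l\<in>L. below I l p) \<and> (\<forall>g\<in>G. below I p g)"

definition selected :: "'a set \<Rightarrow> nat \<Rightarrow> ('a rel \<times> 'a) set \<Rightarrow> bool" where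
  "selected A k I \<longleftrightarrow> (\<exists>p L G. pivot I A p L G \<and> card L = k)"

lemma pivot_mono: "pivot I A p L G \<Longrightarrow> J \<subseteq> I \<Longrightarrow> pivot J A p L G"
  by (auto simp: pivot_def intro: below_mono)

lemma selected_mono: "selected A k I \<Longrightarrow> J \<subseteq> I \<Longrightarrow> selected A k J"
  by (auto simp: selected_def intro: pivot_mono)

lemma pivot_card:
  assumes "pivot I A p L G" "finite A"
  shows "card A = Suc (card L + card G)"
  using assms by (auto simp: pivot_def card_Un_disjoint)

lemma reach_pivot:
  assumes I: "I \<subseteq> instances c xs" and p: "p \<in> A" and A: "A \<subseteq> points c xs"
  shows "reach c xs I (card A - 1) (\<lambda>J. \<exists>L G. pivot J A p L G)"
proof -
  have "finite A" using A by (rule finite_subset_points)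
  have "reach c xs I (card B) (\<lambda>J. \<exists>L G. pivot J (insert p B) p L G)"
    if "finite B" "p \<notin> B" "B \<subseteq> points c xs" for B
    using that
  proof (induction B)
    case empty
    show ?case by (intro reach.stop exI[of _ "{}"]) (simp add: pivot_def)
  next
    case (insert b B)
    have "reach c xs I (card B + 1) (\<lambda>J. \<exists>L G. pivot J (insert p (insert b B)) p L G)"
    proof (rule reach_bind)
      show "reach c xs I (card B) (\<lambda>J. \<exists>L G. pivot J (insert p B) p L G)"
        using insert by auto
    next
      fix J assume J: "J \<subseteq> I" "\<exists>L G. pivot J (insert p B) p L G"
      then obtain L G where LG: "pivot J (insert p B) p L G" by blast
      have "reach c xs J 1 (\<lambda>J. below J b p \<or> below J p b)"
        using J I insert.prems A p by (intro reach_compare) auto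
      then show "reach c xs J 1 (\<lambda>J. \<exists>L G. pivot J (insert p (insert b B)) p L G)"
      proof (rule reach_conseq)
        fix J' assume J': "J' \<subseteq> J" "below J' b p \<or> below J' p b"
        have P: "pivot J' (insert p B) p L G" using pivot_mono LG J'(1) .
        have *: "b \<notin> L" "b \<notin> G" "b \<noteq> p"
          using P insert.hyps insert.prems by (auto simp: pivot_def insert_eq_iff)
        have "pivot J' (insert p (insert b B)) p (insert b L) G" if "below J' b p"
          using P that * unfolding pivot_def by auto
        moreover have "pivot J' (insert p (insert b B)) p L (insert b G)" if "below J' p b"
          using P that * unfolding pivot_def by auto
        ultimately show "\<exists>L G. pivot J' (insert p (insert b B)) p L G" using J'(2) by blast
      qed
    qed
    then show ?case using insert by simp
  qed
  from this[of "A - {p}"] show ?thesis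
    using p A \<open>finite A\<close> by (auto simp: insert_absorb)
qed

text \<open>Through \<open>p\<close>, every element of \<open>G\<close> lies above every element of
  \<open>L\<close>, so ranks in \<open>L\<close> are ranks in \<open>A\<close> and passing from
  \<open>L\<close> to \<open>A\<close> costs no call.\<close>

lemma selected_lower:
  assumes I: "I \<subseteq> instances c xs" and A: "A \<subseteq> points c xs"
    and P: "pivot I A p L G" and S: "selected L k I"
  shows "selected A k I"
proof -
  obtain m L' G' where m: "pivot I L m L' G'" "card L' = k"
    using S by (auto simp: selected_def)
  have X: "m \<in> points c xs" "p \<in> points c xs" "G \<subseteq> points c xs"
    using A P m by (auto simp: pivot_def)
  have mp: "below I m p" using P m by (auto simp: pivot_def)
  have "below I m g" if "g \<in> G" for g
    using below_trans[OF I mp _ X(1,2)] P X(3) that by (auto simp: pivot_def)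
  then have "pivot I A m L' (insert p (G' \<union> G))"
    using P m mp unfolding pivot_def by auto
  then show ?thesis using m(2) by (auto simp: selected_def)
qed

lemma selected_upper:
  assumes I: "I \<subseteq> instances c xs" and A: "A \<subseteq> points c xs"
    and P: "pivot I A p L G" and S: "selected G k I"
  shows "selected A (Suc (card L + k)) I"
proof -
  obtain m L' G' where m: "pivot I G m L' G'" "card L' = k"
    using S by (auto simp: selected_def)
  have X: "m \<in> points c xs" "p \<in> points c xs" "L \<subseteq> points c xs"
    using A P m by (auto simp: pivot_def)
  have pm: "below I p m" using P m by (auto simp: pivot_def)
  have "below I l m" if "l \<in> L" for l
    using below_trans[OF I _ pm _ X(2,1)] P X(3) that by (auto simp: pivot_def)
  then have "pivot I A m (insert p (L' \<union> L)) G'"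
    using P m pm unfolding pivot_def by auto
  moreover have "card (insert p (L' \<union> L)) = Suc (card L + k)"
  proof -
    have "finite L" "finite L'" "p \<notin> L' \<union> L" "L' \<inter> L = {}"
      using P m A finite_subset_points[OF A] unfolding pivot_def by auto
    then show ?thesis using m(2) by (simp add: card_Un_disjoint)
  qed
  ultimately show ?thesis by (auto simp: selected_def)
qed

text \<open>This is the step of quickselect: the rank \<open>k\<close> alone decides which side of
  the pivot is searched, or that the pivot is the answer.\<close>

lemma reach_selected_recurse:
  assumes I: "I \<subseteq> instances c xs" and A: "A \<subseteq> points c xs"
    and P: "pivot I A p L G" and k: "k < card A"
    and L: "\<And>j. j < card L \<Longrightarrow> reach c xs I q (selected L j)"
    and G: "\<And>j. j < card G \<Longrightarrow> reach c xs I q (selected G j)"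
  shows "reach c xs I q (selected A k)"
proof -
  have card: "card A = Suc (card L + card G)"
    using pivot_card[OF P finite_subset_points[OF A]] .
  consider "k < card L" | "k = card L" | j where "k = Suc (card L + j)" "j < card G"
  proof -
    have "k < card L \<or> k = card L \<or> k = Suc (card L + (k - Suc (card L))) \<and> k - Suc (card L) < card G"
      using k card by linarith
    then show ?thesis using that by blast
  qed
  then show ?thesis
  proof cases
    case 1
    from L[OF this] show ?thesis
      by (rule reach_conseq) (use I A P in \<open>blast intro: selected_lower pivot_mono\<close>)
  next
    case 2
    have "selected A k I" using P 2 unfolding selected_def by blast
    then show ?thesis by (rule reach.stop)
  next
    case 3
    from G[OF 3(2)] show ?thesis unfolding 3(1)
      by (rule reach_conseq) (use I A P in \<open>blast intro: selected_upper pivot_mono\<close>)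
  qed
qed

text \<open>Quickselect with an arbitrary pivot; the worst case peels off one element at a time,
  giving \<open>(n - 1) + ... + 1\<close> calls. It serves the small cases, in particular 10 calls
  for the median of five.\<close>

lemma reach_selected_quadratic:
  assumes I: "I \<subseteq> instances c xs" and A: "A \<subseteq> points c xs" and k: "k < card A"
  shows "reach c xs I (card A * (card A - 1) div 2) (selected A k)"
  using assms
proof (induction "card A" arbitrary: A I k rule: less_induct)
  case less
  let ?n = "card A"
  have fin: "finite A" using less.prems(2) by (rule finite_subset_points)
  obtain p where p: "p \<in> A" using less.prems by fastforce
  let ?q = "(?n - 1) * (?n - 2) div 2"
  have "reach c xs I ((?n - 1) + ?q) (selected A k)"
  proof (rule reach_bind[OF reach_pivot[OF less.prems(1) p less.prems(2)]])
    fix J assume J: "J \<subseteq> I" "\<exists>L G. pivot J A p L G"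
    then obtain L G where P: "pivot J A p L G" by blast
    have JI: "J \<subseteq> instances c xs" using J less.prems by auto
    have card: "?n = Suc (card L + card G)" using pivot_card[OF P fin] .
    have sub: "L \<subseteq> points c xs" "G \<subseteq> points c xs" using P less.prems by (auto simp: pivot_def)
    have "reach c xs J ?q (selected B j)" if B: "j < card B" "B \<subseteq> points c xs" "card B < ?n" for B j
    proof (rule reach_mono[OF less.hyps[OF B(3) JI B(2,1)]])
      show "card B * (card B - 1) div 2 \<le> ?q"
        using B(3) by (intro div_le_mono mult_le_mono) auto
    qed
    then show "reach c xs J ?q (selected A k)"
      using card sub by (intro reach_selected_recurse[OF JI less.prems(2) P less.prems(3)]) auto
  qed
  moreover have "(?n - 1) + ?q = ?n * (?n - 1) div 2"
  proof -
    obtain n where n: "?n = Suc n" using less.prems by (cases ?n) auto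
    have "?n * (?n - 1) = n * 2 + n * (n - 1)" unfolding n by (cases n) auto
    then show ?thesis unfolding n by simp
  qed
  ultimately show ?case by simp
qed

section \<open>Median of medians\<close>

lemma obtain_blocks:
  assumes "finite A" "g * b \<le> card A" "b > 0"
  obtains F where "finite F" "card F = g" "\<Union>F \<subseteq> A" "\<forall>B\<in>F. card B = b" "pairwise disjnt F"
proof -
  have "\<exists>F. finite F \<and> card F = g \<and> \<Union>F \<subseteq> A \<and> (\<forall>B\<in>F. card B = b) \<and> pairwise disjnt F"
    using assms(1,2)
  proof (induction g arbitrary: A)
    case 0
    show ?case by (intro exI[of _ "{}"]) auto
  next
    case (Suc g)
    have "b \<le> card A" using Suc.prems by simp
    then obtain B where B: "B \<subseteq> A" "card B = b" "finite B"
      by (rule obtain_subset_with_card_n)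
    then have "g * b \<le> card (A - B)" using Suc.prems by (simp add: card_Diff_subset)
    then obtain F where F: "finite F" "card F = g" "\<Union>F \<subseteq> A - B" "\<forall>B\<in>F. card B = b"
      "pairwise disjnt F"
      using Suc.IH[of "A - B"] Suc.prems by auto
    \<comment> \<open>An empty block could already belong to \<open>F\<close>; positive size rules
      this out, so the family really grows.\<close>
    have "B \<noteq> {}" using B \<open>b > 0\<close> by auto
    then have "B \<notin> F" using F(3) by blast
    moreover have "pairwise disjnt (insert B F)"
      using F(3,5) by (auto simp: pairwise_insert disjnt_def)
    ultimately show ?case using F B by (intro exI[of _ "insert B F"]) auto
  qed
  then show ?thesis using that by blast
qed

lemma inj_on_disjoint_blocks:
  assumes "pairwise disjnt F" and "\<And>B. B \<in> F \<Longrightarrow> m B \<in> B"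
  shows "inj_on m F"
proof (rule inj_onI, rule ccontr)
  fix B B' assume B: "B \<in> F" "B' \<in> F" "m B = m B'" "B \<noteq> B'"
  then have "disjnt B B'" using assms(1) by (auto dest: pairwiseD)
  then show False using assms(2)[OF B(1)] assms(2)[OF B(2)] B(3) by (auto simp: disjnt_def)
qed

lemma selected_empty:
  assumes "k < card A"
  shows "selected A k {}"
proof -
  have "finite A" using assms by (intro card_ge_0_finite) simp
  obtain p where p: "p \<in> A" using assms by fastforce
  then have "k \<le> card (A - {p})" using assms \<open>finite A\<close> by simp
  then obtain L where "L \<subseteq> A - {p}" "card L = k" using obtain_subset_with_card_n by metis
  then have "pivot {} A p L (A - {p} - L)" using p by (auto simp: pivot_def below_def)
  then show ?thesis using \<open>card L = k\<close> by (auto simp: selected_def)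
qed

lemma reach_block_medians:
  assumes I: "I \<subseteq> instances c xs" and F: "finite F" "\<forall>B\<in>F. card B = 5 \<and> B \<subseteq> points c xs"
  shows "reach c xs I (10 * card F) (\<lambda>J. \<forall>B\<in>F. selected B 2 J)"
  using F
proof (induction F)
  case empty
  show ?case by (intro reach.stop) simp
next
  case (insert B F)
  have "reach c xs I (10 * card F + 10) (\<lambda>J. \<forall>B\<in>insert B F. selected B 2 J)"
  proof (rule reach_bind)
    show "reach c xs I (10 * card F) (\<lambda>J. \<forall>B\<in>F. selected B 2 J)" using insert by auto
    fix J assume J: "J \<subseteq> I" "\<forall>B\<in>F. selected B 2 J"
    have "reach c xs J 10 (selected B 2)"
      using reach_selected_quadratic[of J c xs B 2] insert.prems J I by auto
    then show "reach c xs J 10 (\<lambda>J. \<forall>B\<in>insert B F. selected B 2 J)"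
      by (rule reach_conseq) (use J in \<open>auto intro: selected_mono\<close>)
  qed
  then show ?case using insert.hyps by (simp add: algebra_simps)
qed

text \<open>In the application \<open>p B\<close> is the median of block \<open>B\<close>, and
  \<open>H B\<close> is that median with the two elements on one side of it. Blocks are disjoint, so
  each median in \<open>Q\<close> contributes three new elements to \<open>Y\<close>.\<close>

lemma card_blocks_halves:
  assumes F: "finite F" "pairwise disjnt F" and inj: "inj_on p F"
    and H: "\<And>B. B \<in> F \<Longrightarrow> H B \<subseteq> B \<and> card (H B) = 3"
    and Q: "Q \<subseteq> p ` F" and Y: "finite Y" "\<And>B. B \<in> F \<Longrightarrow> p B \<in> Q \<Longrightarrow> H B \<subseteq> Y"
  shows "3 * card Q \<le> card Y"
proof -
  define U where "U = {B \<in> F. p B \<in> Q}"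
  have U: "U \<subseteq> F" "finite U" and Qeq: "Q = p ` U" using F Q by (auto simp: U_def)
  have "card Q = card U"
    unfolding Qeq by (rule card_image) (rule inj_on_subset[OF inj U(1)])
  moreover have "card (\<Union>B\<in>U. H B) = (\<Sum>B\<in>U. card (H B))"
  proof (rule card_UN_disjoint)
    show "\<forall>B\<in>U. finite (H B)" using H U card.infinite by fastforce
    show "\<forall>B\<in>U. \<forall>B'\<in>U. B \<noteq> B' \<longrightarrow> H B \<inter> H B' = {}"
    proof (intro ballI impI)
      fix B B' assume "B \<in> U" "B' \<in> U" "B \<noteq> B'"
      then have "disjnt B B'" "H B \<subseteq> B" "H B' \<subseteq> B'"
        using pairwiseD[OF F(2), of B B'] U H by blast+
      then show "H B \<inter> H B' = {}" unfolding disjnt_def by blast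
    qed
  qed (rule U(2))
  moreover have "(\<Sum>B\<in>U. card (H B)) = 3 * card U"
    using H U(1) by (simp add: subset_iff)
  moreover have "card (\<Union>B\<in>U. H B) \<le> card Y"
    by (rule card_mono[OF Y(1)]) (use Y(2) in \<open>auto simp: U_def\<close>)
  ultimately show ?thesis by simp
qed

text \<open>Cardinalities do not vary with the instance, so one order taken from the nonempty
  \<open>I\<close> suffices. A block whose median is at most \<open>p\<close> has three elements at
  most \<open>p\<close>, none of which can lie in \<open>GA\<close>; dually for
  \<open>LA\<close>.\<close>

lemma median_of_medians_balance:
  assumes I: "I \<subseteq> instances c xs" and ne: "I \<noteq> {}" and A: "A \<subseteq> points c xs"
    and F: "finite F" "pairwise disjnt F" "\<Union>F \<subseteq> A" "\<forall>B\<in>F. card B = 5"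
    and m: "\<And>B. B \<in> F \<Longrightarrow> pivot I B (m B) (L B) (G B) \<and> card (L B) = 2"
    and P: "pivot I (m ` F) p LM GM" and P': "pivot I A p LA GA"
  shows "card GA + 3 * Suc (card LM) \<le> card A" "card LA + 3 * Suc (card GM) \<le> card A"
    "Suc (card LM + card GM) = card F"
proof -
  obtain i where i: "i \<in> I" using ne by blast
  note lin = instances_linear_order[OF I i]
  have fin: "finite A" using finite_subset_points[OF A] .
  have mB: "m B \<in> B" if "B \<in> F" for B using m[OF that] by (auto simp: pivot_def)
  have inj: "inj_on m F" using inj_on_disjoint_blocks[OF F(2)] mB by blast
  have finB: "finite B" "B \<subseteq> A" if "B \<in> F" for B
  proof -
    show "B \<subseteq> A" using that F(3) by blast
    then show "finite B" using fin by (rule finite_subset)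
  qed
  have H: "insert (m B) (L B) \<subseteq> B \<and> card (insert (m B) (L B)) = 3"
          "insert (m B) (G B) \<subseteq> B \<and> card (insert (m B) (G B)) = 3" if B: "B \<in> F" for B
  proof -
    note mB = m[OF B, THEN conjunct1]
    have "card (G B) = 2" "card (L B) = 2"
      using pivot_card[OF mB finB(1)[OF B]] m[OF B] F(4) B by auto
    moreover from this have "finite (L B)" "finite (G B)" by (simp_all add: card_ge_0_finite)
    moreover have "m B \<notin> L B" "m B \<notin> G B"
      "insert (m B) (L B) \<subseteq> B" "insert (m B) (G B) \<subseteq> B"
      using mB unfolding pivot_def by blast+
    ultimately show "insert (m B) (L B) \<subseteq> B \<and> card (insert (m B) (L B)) = 3"
          "insert (m B) (G B) \<subseteq> B \<and> card (insert (m B) (G B)) = 3"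
      by simp_all
  qed
  have X: "x \<in> points c xs" if "B \<in> F" "x \<in> B" for B x using that finB A by blast
  have pX: "p \<in> points c xs" using P' A by (auto simp: pivot_def)
  define le where "le a b \<longleftrightarrow> (a, b) \<in> fst i" for a b
  have le_trans: "le a b \<Longrightarrow> le b d \<Longrightarrow> le a d" for a b d
    unfolding le_def using linear_order_trans[OF lin] .
  have le: "le a b" if "below I a b" "a \<in> points c xs" "b \<in> points c xs" for a b
    using that i linear_order_cases[OF lin that(2,3)] by (auto simp: below_def le_def)
  have refl: "le p p" using linear_order_refl[OF lin pX] by (simp add: le_def)
  have low: "le x p" if "B \<in> F" "m B \<in> insert p LM" "x \<in> insert (m B) (L B)" for B x
  proof -
    have "x = m B \<or> le x (m B)"
      using le[of x "m B"] m[OF that(1)] that X mB H(1)[OF that(1)] by (auto simp: pivot_def)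
    moreover have "le (m B) p"
      using le[of "m B" p] refl P that X mB pX by (auto simp: pivot_def)
    ultimately show ?thesis using le_trans by blast
  qed
  have high: "le p x" if "B \<in> F" "m B \<in> insert p GM" "x \<in> insert (m B) (G B)" for B x
  proof -
    have "x = m B \<or> le (m B) x"
      using le[of "m B" x] m[OF that(1)] that X mB H(2)[OF that(1)] by (auto simp: pivot_def)
    moreover have "le p (m B)"
      using le[of p "m B"] refl P that X mB pX by (auto simp: pivot_def)
    ultimately show ?thesis using le_trans by blast
  qed
  have finLG: "finite LA" "finite GA" using P' fin by (auto simp: pivot_def)
  have "3 * card (insert p LM) \<le> card (A - GA)"
  proof (rule card_blocks_halves[OF F(1,2) inj H(1)])
    fix B assume B: "B \<in> F" "m B \<in> insert p LM"
    show "insert (m B) (L B) \<subseteq> A - GA"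
    proof
      fix x assume x: "x \<in> insert (m B) (L B)"
      have "x \<notin> GA" using low[OF B x] P' i by (auto simp: pivot_def below_def le_def)
      then show "x \<in> A - GA" using x H(1)[OF B(1)] finB[OF B(1)] by blast
    qed
  qed (use P fin in \<open>auto simp: pivot_def\<close>)
  moreover have "3 * card (insert p GM) \<le> card (A - LA)"
  proof (rule card_blocks_halves[OF F(1,2) inj H(2)])
    fix B assume B: "B \<in> F" "m B \<in> insert p GM"
    show "insert (m B) (G B) \<subseteq> A - LA"
    proof
      fix x assume x: "x \<in> insert (m B) (G B)"
      have "x \<notin> LA" using high[OF B x] P' i by (auto simp: pivot_def below_def le_def)
      then show "x \<in> A - LA" using x H(2)[OF B(1)] finB[OF B(1)] by blast
    qed
  qed (use P fin in \<open>auto simp: pivot_def\<close>)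
  moreover have "finite LM" "finite GM" "p \<notin> LM" "p \<notin> GM"
  proof -
    have "finite (insert p (LM \<union> GM))" using P finite_imageI[OF F(1)] unfolding pivot_def by metis
    then show "finite LM" "finite GM" by auto
  qed (use P in \<open>auto simp: pivot_def\<close>)
  moreover have "card (A - GA) = card A - card GA" "card (A - LA) = card A - card LA"
    "card GA \<le> card A" "card LA \<le> card A"
  proof -
    have "LA \<subseteq> A" "GA \<subseteq> A" using P' by (auto simp: pivot_def)
    then show "card (A - GA) = card A - card GA" "card (A - LA) = card A - card LA"
      "card GA \<le> card A" "card LA \<le> card A"
      using finLG fin by (auto simp: card_Diff_subset intro: card_mono)
  qed
  ultimately show "card GA + 3 * Suc (card LM) \<le> card A" "card LA + 3 * Suc (card GM) \<le> card A"
    by auto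
  show "Suc (card LM + card GM) = card F"
    using pivot_card[OF P] F(1) card_image[OF inj] by simp
qed

lemma reach_selected:
  assumes I: "I \<subseteq> instances c xs" and A: "A \<subseteq> points c xs" and k: "k < card A"
  shows "reach c xs I (33 * (card A - 1)) (selected A k)"
  using assms
proof (induction "card A" arbitrary: A I k rule: less_induct)
  case less
  let ?n = "card A"
  define g where "g = ?n div 5"
  show ?case
  proof (cases "?n < 5")
    case True
    have "?n * (?n - 1) div 2 \<le> 33 * (?n - 1)"
      using True mult_le_mono1[of ?n 66 "?n - 1"] by linarith
    then show ?thesis using reach_mono[OF reach_selected_quadratic[OF less.prems]] by simp
  next
    case False
    have fin: "finite A" using less.prems(2) by (rule finite_subset_points)
    have g: "0 < g" "g < ?n" "g * 5 \<le> ?n" "?n \<le> g * 5 + 4" using False by (auto simp: g_def)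
    obtain F where F: "finite F" "card F = g" "\<Union>F \<subseteq> A" "\<forall>B\<in>F. card B = 5" "pairwise disjnt F"
      using obtain_blocks[OF fin g(3)] by auto
    \<comment> \<open>With this lower median rank, at least \<open>h\<close> medians lie on each
      side of \<open>p\<close>, so each side of the final split misses at least
      \<open>3 * Suc h\<close> elements of \<open>A\<close>.\<close>
    define h where "h = (g - 1) div 2"
    define q where "q = 33 * (?n - 3 * Suc h - 1)"
    have hg: "h < g" "g \<le> 2 * h + 2" "2 * h + 1 \<le> g" using g(1) by (auto simp: h_def)
    \<comment> \<open>The summands pay for the block medians, the recursive search for their median
      \<open>p\<close>, the comparisons of \<open>A\<close> with \<open>p\<close>, and the recursion
      into one side.\<close>
    have "reach c xs I (10 * g + (33 * (g - 1) + ((?n - 1) + q))) (selected A k)"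
    proof (rule reach_bind)
      show "reach c xs I (10 * g) (\<lambda>J. \<forall>B\<in>F. selected B 2 J)"
        using reach_block_medians[OF less.prems(1) F(1)] F less.prems(2) by auto
    next
      fix I1 assume I1: "I1 \<subseteq> I" "\<forall>B\<in>F. selected B 2 I1"
      then obtain m L G where m: "\<And>B. B \<in> F \<Longrightarrow> pivot I1 B (m B) (L B) (G B) \<and> card (L B) = 2"
        unfolding selected_def by metis
      have mB: "m B \<in> B" if "B \<in> F" for B using m[OF that] by (auto simp: pivot_def)
      have "inj_on m F" using inj_on_disjoint_blocks[OF F(5)] mB by blast
      then have cM: "card (m ` F) = g" using F(2) by (simp add: card_image)
      have MA: "m ` F \<subseteq> A" using mB F(3) by blast
      show "reach c xs I1 (33 * (g - 1) + ((?n - 1) + q)) (selected A k)"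
      proof (rule reach_bind)
        show "reach c xs I1 (33 * (g - 1)) (selected (m ` F) h)"
          using less.hyps[of "m ` F" I1 h] cM g(2) hg MA I1 less.prems by auto
      next
        fix I2 assume I2: "I2 \<subseteq> I1" "selected (m ` F) h I2"
        then obtain p LM GM where P: "pivot I2 (m ` F) p LM GM" "card LM = h"
          by (auto simp: selected_def)
        have "p \<in> A" using P MA by (auto simp: pivot_def)
        show "reach c xs I2 ((?n - 1) + q) (selected A k)"
        proof (rule reach_bind)
          show "reach c xs I2 (?n - 1) (\<lambda>J. \<exists>L G. pivot J A p L G)"
            using reach_pivot[OF _ \<open>p \<in> A\<close> less.prems(2)] I2 I1 less.prems by auto
        next
          fix I3 assume I3: "I3 \<subseteq> I2" "\<exists>L G. pivot I3 A p L G"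
          then obtain LA GA where P': "pivot I3 A p LA GA" by blast
          have I3I: "I3 \<subseteq> instances c xs" using I3 I2 I1 less.prems by auto
          show "reach c xs I3 q (selected A k)"
          \<comment> \<open>Contradictory answers leave no order in which to count, but then any
            split of the right size qualifies.\<close>
          proof (cases "I3 = {}")
            case True
            then show ?thesis using selected_empty less.prems by (auto intro: reach.stop)
          next
            case False
            note bal = median_of_medians_balance[OF I3I False less.prems(2) F(1,5,3,4) _
                pivot_mono[OF P(1) I3(1)] P']
            have m3: "pivot I3 B (m B) (L B) (G B) \<and> card (L B) = 2" if "B \<in> F" for B
              using m[OF that] I3(1) I2(1) pivot_mono[of I1 _ _ _ _ I3] by (meson subset_trans)
            have "card GA \<le> ?n - 3 * Suc h" "card LA \<le> ?n - 3 * Suc h"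
              using bal[OF m3] P(2) F(2) hg by auto
            then have sub: "reach c xs I3 q (selected B j)"
              if "j < card B" "B = LA \<or> B = GA" for B j
            proof -
              have "card B \<le> ?n - 3 * Suc h" "B \<subseteq> points c xs"
                using that \<open>card GA \<le> _\<close> \<open>card LA \<le> _\<close> P' less.prems by (auto simp: pivot_def)
              moreover from this have "card B < ?n" using g diff_less[of "3 * Suc h" ?n] by auto
              ultimately have "reach c xs I3 (33 * (card B - 1)) (selected B j)"
                using less.hyps[OF _ I3I _ that(1)] by blast
              then show ?thesis
                unfolding q_def
                by (rule reach_mono) (use \<open>card B \<le> _\<close> in \<open>intro mult_le_mono diff_le_mono order_refl\<close>)
            qed
            show ?thesis
              by (rule reach_selected_recurse[OF I3I less.prems(2) P' less.prems(3)]) (auto intro: sub)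
          qed
        qed
      qed
    qed
    moreover have "10 * g + (33 * (g - 1) + ((?n - 1) + q)) \<le> 33 * (?n - 1)"
    proof -
      \<comment> \<open>As \<open>3 * Suc h >= 1.5 g\<close>, the left side is at most
        \<open>33 n - 6.5 g - 33\<close> unless the subtraction truncates, and
        \<open>n <= 5 g + 4\<close>. Truncation is the other case.\<close>
      have "43 * g + 33 * (?n - 3 * Suc h - 1) \<le> 32 * ?n + 1"
        using g hg by (cases "3 * Suc h + 1 \<le> ?n") auto
      then show ?thesis unfolding q_def using g by simp
    qed
    ultimately show ?thesis by (rule reach_mono)
  qed
qed

section \<open>Halving\<close>

text \<open>A game position: \<open>t\<close> rounds are over, \<open>I\<close> is the knowledge,
  and \<open>q\<close> calls and \<open>m\<close> mistakes remain. The rule \<open>vacuous\<close>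
  discards answers that no instance gives; a wrong prediction must be impossible or be paid from
  \<open>m\<close>.\<close>

inductive win ::
  "'a convention \<Rightarrow> 'a list \<Rightarrow> nat \<Rightarrow> ('a rel \<times> 'a) set \<Rightarrow> nat \<Rightarrow> nat \<Rightarrow> bool"
  for c xs where
  over: "length xs \<le> t \<Longrightarrow> win c xs t I q m"
| vacuous: "win c xs t {} q m"
| call: "S \<subseteq> points c xs \<times> UNIV \<Longrightarrow> win c xs t {i \<in> I. query c xs i S} q m \<Longrightarrow>
    win c xs t {i \<in> I. \<not> query c xs i S} q m \<Longrightarrow> win c xs t I (Suc q) m"
| predict: "win c xs (Suc t) {i \<in> I. label i (xs ! t) = p} q m \<Longrightarrow>
    {i \<in> I. label i (xs ! t) \<noteq> p} = {} \<or>
      m > 0 \<and> win c xs (Suc t) {i \<in> I. label i (xs ! t) \<noteq> p} q (m - 1) \<Longrightarrow>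
    win c xs t I q m"

lemma win_mono: "win c xs t I q m \<Longrightarrow> q \<le> q' \<Longrightarrow> win c xs t I q' m"
proof (induction arbitrary: q' rule: win.induct)
  case (call S t I q m)
  then obtain q'' where "q' = Suc q''" "q \<le> q''" by (cases q') auto
  with call show ?case by (auto intro: win.call)
next
  case (predict t I p q m)
  have "win c xs (Suc t) {i \<in> I. label i (xs ! t) = p} q' m"
    using predict by blast
  then show ?case by (rule win.predict) (use predict in blast)
qed (auto intro: win.over win.vacuous)

text \<open>Calls do not advance the round, so a query tree can be played before any
  prediction.\<close>

lemma reach_win:
  assumes "reach c xs I q P" and "\<And>J. J \<subseteq> I \<Longrightarrow> P J \<Longrightarrow> win c xs t J q' m"
  shows "win c xs t I (q + q') m"
  using assms
proof (induction rule: reach.induct)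
  case (stop P I q)
  show ?case by (rule win_mono[OF stop(2)]) (use stop in auto)
next
  case (ask S I q P)
  have "win c xs t I (Suc (q + q')) m"
  proof (rule win.call[OF ask.hyps(1)])
    show "win c xs t {i \<in> I. query c xs i S} (q + q') m"
      by (rule ask.IH(1)) (use ask.prems in blast)
    show "win c xs t {i \<in> I. \<not> query c xs i S} (q + q') m"
      by (rule ask.IH(2)) (use ask.prems in blast)
  qed
  then show ?case by simp
qed

section \<open>From a won game position to a learner\<close>

definition compatible ::
  "'a convention \<Rightarrow> 'a list \<Rightarrow> 'a transcript \<Rightarrow> ('a rel \<times> 'a) set" where
  "compatible c xs tr = {i \<in> instances c xs.
     \<forall>k<length tr. snd (tr ! k) = answer c xs i (take k tr) (fst (tr ! k))}"

lemma compatible_Nil: "compatible c xs [] = instances c xs"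
  by (simp add: compatible_def)

lemma compatible_snoc:
  "compatible c xs (tr @ [(a, b)]) = {i \<in> compatible c xs tr. answer c xs i tr a = b}"
  by (auto simp: compatible_def nth_append less_Suc_eq)

lemma rounds_done_Nil [simp]: "rounds_done [] = 0"
  by (simp add: rounds_done_def)

lemma rounds_done_snoc [simp]:
  "rounds_done (tr @ [e]) = (if is_call e then rounds_done tr else Suc (rounds_done tr))"
  by (simp add: rounds_done_def)

definition num_calls :: "'a transcript \<Rightarrow> nat" where
  "num_calls tr = length (filter is_call tr)"

definition num_mistakes :: "'a transcript \<Rightarrow> nat" where
  "num_mistakes tr = length (filter is_mistake tr)"

lemma num_Nil [simp]: "num_calls [] = 0" "num_mistakes [] = 0"
  by (simp_all add: num_calls_def num_mistakes_def)

lemma num_snoc [simp]: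
  "num_calls (tr @ [e]) = (if is_call e then Suc (num_calls tr) else num_calls tr)"
  "num_mistakes (tr @ [e]) = (if is_mistake e then Suc (num_mistakes tr) else num_mistakes tr)"
  by (simp_all add: num_calls_def num_mistakes_def)

text \<open>The inequalities on the spent budgets stand separately because the truncated
  subtractions would hide overspending.\<close>

definition winning ::
  "'a convention \<Rightarrow> 'a list \<Rightarrow> nat \<Rightarrow> nat \<Rightarrow> 'a transcript \<Rightarrow> bool" where
  "winning c xs q m tr \<longleftrightarrow> num_calls tr \<le> q \<and> num_mistakes tr \<le> m \<and>
     win c xs (rounds_done tr) (compatible c xs tr) (q - num_calls tr) (m - num_mistakes tr)"

definition legal_action :: "'a convention \<Rightarrow> 'a list \<Rightarrow> 'a action \<Rightarrow> bool" where
  "legal_action c xs a \<longleftrightarrow> (\<forall>S. a = Call S \<longrightarrow> S \<subseteq> points c xs \<times> UNIV)"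

lemma winning_step:
  assumes W: "winning c xs q m tr" and t: "rounds_done tr < length xs"
    and ne: "compatible c xs tr \<noteq> {}"
  shows "\<exists>a. legal_action c xs a \<and>
    (\<forall>b. compatible c xs (tr @ [(a, b)]) \<noteq> {} \<longrightarrow> winning c xs q m (tr @ [(a, b)]))"
proof -
  have le: "num_calls tr \<le> q" "num_mistakes tr \<le> m"
    and win: "win c xs (rounds_done tr) (compatible c xs tr) (q - num_calls tr) (m - num_mistakes tr)"
    using W by (auto simp: winning_def)
  from win show ?thesis
  proof cases
    case over
    then show ?thesis using t by simp
  next
    case vacuous
    then show ?thesis using ne by simp
  next
    case (call S q')
    have "num_calls tr < q" "q - Suc (num_calls tr) = q'" using call(1) by auto
    then have "winning c xs q m (tr @ [(Call S, b)])" for b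
      using call le by (cases b) (auto simp: winning_def compatible_snoc)
    then show ?thesis using call by (intro exI[of _ "Call S"]) (auto simp: legal_action_def)
  next
    case (predict p)
    have "winning c xs q m (tr @ [(Predict p, b)])"
      if "compatible c xs (tr @ [(Predict p, b)]) \<noteq> {}" for b
    proof (cases "b = p")
      case True
      then show ?thesis using predict le by (simp add: winning_def compatible_snoc)
    next
      case False
      let ?N = "{i \<in> compatible c xs tr. label i (xs ! rounds_done tr) \<noteq> p}"
      have N: "compatible c xs (tr @ [(Predict p, b)]) = ?N"
        using False by (auto simp: compatible_snoc)
      then have "m - num_mistakes tr > 0"
        "win c xs (Suc (rounds_done tr)) ?N (q - num_calls tr) (m - num_mistakes tr - 1)"
        using predict(2) that by auto
      then show ?thesis using N False le by (simp add: winning_def)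
    qed
    then show ?thesis by (intro exI[of _ "Predict p"]) (auto simp: legal_action_def)
  qed
qed

lemma transcript_Suc:
  "transcript c xs L i (Suc n) = (let tr = transcript c xs L i n in
      if rounds_done tr < length xs then tr @ [(L tr, answer c xs i tr (L tr))] else tr)"
  by simp

lemma winning_learner:
  assumes "win c xs 0 (instances c xs) q m"
  obtains L where "legal_learner c xs L"
    "\<And>i. i \<in> instances c xs \<Longrightarrow> calls c xs L i \<le> enat q \<and> mistakes c xs L i \<le> enat m"
proof -
  define good where "good tr a \<longleftrightarrow> legal_action c xs a \<and>
    (\<forall>b. compatible c xs (tr @ [(a, b)]) \<noteq> {} \<longrightarrow> winning c xs q m (tr @ [(a, b)]))" for tr a
  \<comment> \<open>The default keeps \<open>L\<close> legal on transcripts that never occur in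
    play, since legality ranges over all transcripts.\<close>
  define L where "L tr = (if \<exists>a. good tr a then SOME a. good tr a else Predict True)" for tr
  have good: "good tr (L tr)" if "\<exists>a. good tr a" for tr
    unfolding L_def using someI_ex[OF that] that by simp
  have "legal_action c xs (L tr)" for tr
    using good[of tr] by (cases "\<exists>a. good tr a") (auto simp: good_def L_def legal_action_def)
  then have legal: "legal_learner c xs L"
    by (auto simp: legal_learner_def legal_action_def)
  have inv: "i \<in> compatible c xs (transcript c xs L i n) \<and> winning c xs q m (transcript c xs L i n)"
    if "i \<in> instances c xs" for i n
  proof (induction n)
    case 0
    then show ?case using that assms by (simp add: compatible_Nil winning_def)
  next
    case (Suc n)
    let ?tr = "transcript c xs L i n"
    show ?case
    proof (cases "rounds_done ?tr < length xs")
      case True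
      \<comment> \<open>The true instance is always compatible, so the knowledge is nonempty and a
        good action exists.\<close>
      have "\<exists>a. good ?tr a"
        unfolding good_def using winning_step[OF _ True] Suc by blast
      from good[OF this] have "good ?tr (L ?tr)" .
      moreover have "i \<in> compatible c xs (?tr @ [(L ?tr, answer c xs i ?tr (L ?tr))])"
        using Suc by (simp add: compatible_snoc)
      ultimately show ?thesis using True by (auto simp: Let_def good_def)
    next
      case False
      then show ?thesis using Suc by (simp add: Let_def)
    qed
  qed
  show ?thesis
  proof (rule that[OF legal])
    fix i assume "i \<in> instances c xs"
    from inv[OF this] show "calls c xs L i \<le> enat q \<and> mistakes c xs L i \<le> enat m"
      unfolding calls_def mistakes_def winning_def num_calls_def num_mistakes_def
      by (auto intro!: SUP_least)
  qed
qed

text \<open>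
  The candidates for \<open>z\<close> form an order interval \<open>V\<close>; the labels of all points outside \<open>V\<close> are known.
\<close>

definition version_space :: "'a convention \<Rightarrow> 'a list \<Rightarrow> ('a rel \<times> 'a) set \<Rightarrow> 'a set \<Rightarrow> bool" where
  "version_space c xs I V \<longleftrightarrow> I \<subseteq> instances c xs \<and> V \<subseteq> points c xs \<and> (\<forall>i\<in>I. snd i \<in> V) \<and>
     (\<forall>x\<in>points c xs - V. \<exists>y. \<forall>i\<in>I. label i x = y)"

lemma version_space_mono: "version_space c xs I V \<Longrightarrow> J \<subseteq> I \<Longrightarrow> version_space c xs J V"
  unfolding version_space_def by (meson subset_iff)

lemma label_iff: "label i x \<longleftrightarrow> (x, snd i) \<in> fst i"
  by (simp add: label_def threshold_def)

text \<open>Label 0 at a point up to \<open>p\<close> forces \<open>z\<close> strictly below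
  \<open>p\<close>; label 1 at a point of \<open>G\<close> forces it strictly above. Either mistake
  eliminates \<open>p\<close> as well, and the points of \<open>V\<close> that are dropped get a
  constant label.\<close>

lemma version_space_pivot:
  assumes V: "version_space c xs I V" and P: "pivot I V p L G"
  shows "x \<in> insert p L \<Longrightarrow> version_space c xs {i \<in> I. \<not> label i x} L"
    and "x \<in> G \<Longrightarrow> version_space c xs {i \<in> I. label i x} G"
proof -
  have I: "I \<subseteq> instances c xs" and VX: "V \<subseteq> points c xs" and z: "\<And>i. i \<in> I \<Longrightarrow> snd i \<in> V"
    and outside: "\<And>x. x \<in> points c xs - V \<Longrightarrow> \<exists>y. \<forall>i\<in>I. label i x = y"
    using V by (auto simp: version_space_def)
  have V_eq: "V = insert p (L \<union> G)" using P by (simp add: pivot_def)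
  have sub: "insert p (L \<union> G) \<subseteq> points c xs" using VX V_eq by simp
  have lin: "linear_order_on (points c xs) (fst i)" if "i \<in> I" for i
    using instances_linear_order[OF I that] .
  have L: "(l, p) \<in> fst i \<and> (p, l) \<notin> fst i" if "l \<in> L" "i \<in> I" for l i
    using linear_order_cases[OF lin[OF that(2)], of l p] P that sub by (auto simp: pivot_def below_def)
  have G: "(p, g) \<in> fst i \<and> (g, p) \<notin> fst i" if "g \<in> G" "i \<in> I" for g i
    using linear_order_cases[OF lin[OF that(2)], of p g] P that sub by (auto simp: pivot_def below_def)
  have pp: "(p, p) \<in> fst i" if "i \<in> I" for i
    using linear_order_refl[OF lin[OF that]] sub by simp
  note trans = linear_order_trans[OF lin]
  have up: "label i y" if "i \<in> I" "y \<in> insert p L" "snd i \<in> insert p G" for i y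
    unfolding label_iff using that L G pp trans[OF that(1)] by blast
  have down: "\<not> label i y" if "i \<in> I" "y \<in> insert p G" "snd i \<in> L" for i y
    unfolding label_iff using that L G trans[OF that(1)] by blast
  show "version_space c xs {i \<in> I. \<not> label i x} L" if x: "x \<in> insert p L"
  proof -
    have z': "snd i \<in> L" if "i \<in> I" "\<not> label i x" for i
      using up[OF that(1) x] z[OF that(1)] that(2) V_eq by blast
    have "\<exists>b. \<forall>i\<in>{i \<in> I. \<not> label i x}. label i y = b" if y: "y \<in> points c xs - L" for y
    proof (cases "y \<in> V")
      case True
      then show ?thesis using y V_eq down z' by (intro exI[of _ False]) auto
    next
      case False
      then show ?thesis using y outside by fastforce
    qed
    then show ?thesis using I sub z' by (auto simp: version_space_def)
  qed
  show "version_space c xs {i \<in> I. label i x} G" if x: "x \<in> G"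
  proof -
    have gp: "\<not> label i x" if "i \<in> I" "snd i = p" for i
      unfolding label_iff using G[OF x that(1)] that(2) by simp
    have z': "snd i \<in> G" if "i \<in> I" "label i x" for i
      using down[OF that(1), of x] gp[OF that(1)] z[OF that(1)] that(2) V_eq x by blast
    have "\<exists>b. \<forall>i\<in>{i \<in> I. label i x}. label i y = b" if y: "y \<in> points c xs - G" for y
    proof (cases "y \<in> V")
      case True
      then show ?thesis using y V_eq up z' by (intro exI[of _ True]) auto
    next
      case False
      then show ?thesis using y outside by fastforce
    qed
    then show ?thesis using I sub z' by (auto simp: version_space_def)
  qed
qed

text \<open>
  The pivot stays fixed until the next mistake, so that correct predictions need no further calls.
\<close>

lemma win_until_mistake:
  assumes V: "version_space c xs I V" and P: "pivot I V p L G"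
    and step: "\<And>t J B. J \<subseteq> I \<Longrightarrow> B = L \<or> B = G \<Longrightarrow> version_space c xs J B \<Longrightarrow> J \<noteq> {} \<Longrightarrow>
      m > 0 \<and> win c xs t J q (m - 1)"
  shows "win c xs t I q m"
proof -
  have "win c xs t J q m" if "J \<subseteq> I" for J
    using that
  proof (induction "length xs - t" arbitrary: t J)
    case 0
    then show ?case by (intro win.over) simp
  next
    case (Suc d)
    let ?x = "xs ! t"
    have x: "?x \<in> points c xs" using Suc.hyps(2) set_subset_points nth_mem[of t xs] by fastforce
    have VJ: "version_space c xs J V" and PJ: "pivot J V p L G"
      using version_space_mono[OF V] pivot_mono[OF P] Suc.prems by auto
    have IH: "win c xs (Suc t) {i \<in> J. label i ?x = b} q m" for b
      by (rule Suc.hyps(1)) (use Suc.hyps(2) Suc.prems in auto)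
    \<comment> \<open>The prediction is the label given by threshold \<open>p\<close>, or the
      already known label if the point lies outside \<open>V\<close>.\<close>
    have "\<exists>b. {i \<in> J. label i ?x \<noteq> b} = {} \<or>
        (\<exists>B. (B = L \<or> B = G) \<and> version_space c xs {i \<in> J. label i ?x \<noteq> b} B)"
    proof (cases "?x \<in> V")
      case True
      then have "?x \<in> insert p L \<or> ?x \<in> G" using P by (auto simp: pivot_def)
      then show ?thesis
      proof
        assume "?x \<in> insert p L"
        from version_space_pivot(1)[OF VJ PJ this] show ?thesis by (intro exI[of _ True]) auto
      next
        assume "?x \<in> G"
        from version_space_pivot(2)[OF VJ PJ this] show ?thesis by (intro exI[of _ False]) auto
      qed
    next
      case False
      then have "\<exists>b. \<forall>i\<in>J. label i ?x = b" using VJ x unfolding version_space_def by blast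
      then obtain b where "\<forall>i\<in>J. label i ?x = b" ..
      then show ?thesis by blast
    qed
    then obtain b where b: "{i \<in> J. label i ?x \<noteq> b} = {} \<or>
        (\<exists>B. (B = L \<or> B = G) \<and> version_space c xs {i \<in> J. label i ?x \<noteq> b} B)" ..
    have "{i \<in> J. label i ?x \<noteq> b} \<subseteq> I" using Suc.prems by blast
    note step' = step[OF this, of _ "Suc t"]
    show ?case
      by (rule win.predict[OF IH[of b]]) (use b step' in blast)
  qed
  then show ?thesis by simp
qed

lemma win_halving:
  assumes "version_space c xs I V" and "card V < 2 ^ Suc m"
  shows "win c xs t I (66 * (card V - 1)) m"
  using assms
proof (induction "card V" arbitrary: I V t m rule: less_induct)
  case less
  let ?n = "card V"
  have V: "I \<subseteq> instances c xs" "V \<subseteq> points c xs" "\<And>i. i \<in> I \<Longrightarrow> snd i \<in> V"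
    using less.prems(1) by (auto simp: version_space_def)
  have fin: "finite V" using V(2) by (rule finite_subset_points)
  show ?case
  proof (cases "I = {}")
    case True
    then show ?thesis by (simp add: win.vacuous)
  next
    case False
    then have "V \<noteq> {}" using V by blast
    then have pos: "0 < ?n" using fin by (simp add: card_gt_0_iff)
    \<comment> \<open>Calls reserved for the time after the next mistake. Adding
      \<open>33 * (n - 1)\<close> stays within \<open>66 * (n - 1)\<close>; for \<open>n = 1\<close>
      truncation makes both terms zero.\<close>
    let ?q = "66 * (?n div 2 - 1)"
    have "win c xs t I (33 * (?n - 1) + ?q) m"
    proof (rule reach_win)
      show "reach c xs I (33 * (?n - 1)) (selected V ((?n - 1) div 2))"
        using pos by (intro reach_selected V) auto
    next
      fix J assume J: "J \<subseteq> I" "selected V ((?n - 1) div 2) J"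
      then obtain p L G where P: "pivot J V p L G" "card L = (?n - 1) div 2"
        by (auto simp: selected_def)
      have half: "card L \<le> ?n div 2" "card G \<le> ?n div 2"
        using pivot_card[OF P(1) fin] P(2) by auto
      show "win c xs t J ?q m"
      proof (rule win_until_mistake[OF version_space_mono[OF less.prems(1) J(1)] P(1)])
        fix t' K B assume K: "B = L \<or> B = G" "version_space c xs K B" "K \<noteq> {}"
        have "B \<noteq> {}" "finite B"
          using K finite_subset_points by (auto simp: version_space_def)
        then have "0 < card B" by (simp add: card_gt_0_iff)
        moreover have B: "card B \<le> ?n div 2" using K half by auto
        \<comment> \<open>A mistake leaves a nonempty half, so there were at least two candidates
          and the size hypothesis gives \<open>m > 0\<close>.\<close>
        ultimately have "?n \<ge> 2" by linarith
        then obtain m' where m': "m = Suc m'" using less.prems(2) by (cases m) auto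
        have "win c xs t' K (66 * (card B - 1)) m'"
          using less.hyps[of B] K(2) B pos less.prems(2) m' by auto
        then have "win c xs t' K ?q m'"
          by (rule win_mono) (use B in auto)
        then show "m > 0 \<and> win c xs t' K ?q (m - 1)" using m' by simp
      qed
    qed
    moreover have "33 * (?n - 1) + ?q \<le> 66 * (?n - 1)" using pos by auto
    ultimately show ?thesis by (rule win_mono)
  qed
qed

lemma halving_learner:
  assumes "points c xs \<noteq> {}"
  obtains L where "legal_learner c xs L"
    "\<forall>i\<in>instances c xs. calls c xs L i \<le> enat (66 * (card (points c xs) - 1)) \<and>
       mistakes c xs L i \<le> enat (nat \<lfloor>log 2 (real (card (points c xs)))\<rfloor>)"
proof -
  let ?n = "card (points c xs)"
  let ?m = "nat \<lfloor>log 2 (real ?n)\<rfloor>"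
  have n: "1 \<le> ?n" using assms by (simp add: Suc_le_eq card_gt_0_iff)
  have "log 2 (real ?n) < real (Suc ?m)" by linarith
  then have "real ?n < 2 powr real (Suc ?m)" using n by (simp add: log_less_iff)
  then have "real ?n < 2 ^ Suc ?m" by (simp only: powr_realpow)
  then have "?n < 2 ^ Suc ?m" by (metis of_nat_less_iff of_nat_numeral of_nat_power)
  moreover have "version_space c xs (instances c xs) (points c xs)"
    by (auto simp: version_space_def instances_def)
  ultimately have "win c xs 0 (instances c xs) (66 * (?n - 1)) ?m"
    by (intro win_halving)
  from winning_learner[OF this] obtain L where "legal_learner c xs L"
    "\<And>i. i \<in> instances c xs \<Longrightarrow> calls c xs L i \<le> enat (66 * (?n - 1)) \<and> mistakes c xs L i \<le> enat ?m"
    by blast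
  then show ?thesis using that[of L] by simp
qed

section \<open>The counting lower bound\<close>

lemma length_transcript: "num_calls tr + rounds_done tr = length tr"
  unfolding num_calls_def rounds_done_def by (rule sum_length_filter_compl)

lemma rounds_done_transcript_le: "rounds_done (transcript c xs L i n) \<le> length xs"
  by (induction n) (auto simp: Let_def)

lemma length_transcript_unfinished:
  "rounds_done (transcript c xs L i n) < length xs \<Longrightarrow> length (transcript c xs L i n) = n"
proof (induction n)
  case (Suc n)
  then show ?case by (cases "rounds_done (transcript c xs L i n) < length xs") (auto simp: Let_def)
qed simp

lemma transcript_labels:
  "map snd (filter (\<lambda>e. \<not> is_call e) (transcript c xs L i n)) =
     map (label i) (take (rounds_done (transcript c xs L i n)) xs)"
proof (induction n)
  case (Suc n)
  let ?tr = "transcript c xs L i n"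
  show ?case
  proof (cases "rounds_done ?tr < length xs")
    case True
    then show ?thesis
      using Suc by (cases "L ?tr") (auto simp: Let_def take_Suc_conv_app_nth)
  qed (use Suc in \<open>simp add: Let_def\<close>)
qed simp

definition cost :: "'a transcript \<Rightarrow> nat" where
  "cost tr = num_calls tr + num_mistakes tr"

text \<open>
  A call halves the weight on both branches; a prediction multiplies it by \<open>2/3\<close> on the correct branch
  and by \<open>1/3\<close> on the other one. Hence the weight is conserved along the tree of transcripts.
\<close>

definition weight :: "'a transcript \<Rightarrow> real" where
  "weight tr = (1 / 2) ^ cost tr * (2 / 3) ^ rounds_done tr"

lemma weight_nonneg: "0 \<le> weight tr"
  by (simp add: weight_def)

lemma sum_UN_le:
  fixes f :: "'b \<Rightarrow> real"
  assumes "finite A" "\<And>a. a \<in> A \<Longrightarrow> finite (B a)" "\<And>x. 0 \<le> f x"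
  shows "sum f (\<Union>a\<in>A. B a) \<le> (\<Sum>a\<in>A. sum f (B a))"
  using assms(1,2)
proof (induction A)
  case (insert a A)
  have "sum f (B a \<union> (\<Union>a\<in>A. B a)) \<le> sum f (B a) + sum f (\<Union>a\<in>A. B a)"
    using insert sum.union_inter[of "B a" "\<Union>a\<in>A. B a" f]
      sum_nonneg[of "B a \<inter> (\<Union>a\<in>A. B a)" f] assms(3) by auto
  then show ?case using insert by auto
qed simp

lemma weight_children: "weight (tr @ [(a, True)]) + weight (tr @ [(a, False)]) = weight tr"
  by (cases a) (auto simp: weight_def cost_def)

text \<open>The action \<open>L tr\<close> is fixed by the transcript, so an unfinished transcript
  has at most two successors, which share its weight, and a finished one stays. Summing over the
  image counts coinciding transcripts once.\<close>

lemma kraft: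
  assumes "finite Y"
  shows "sum weight ((\<lambda>i. transcript c xs L i n) ` Y) \<le> 1"
proof (induction n)
  case 0
  \<comment> \<open>Only an inequality, since \<open>Y\<close> may be empty; every transcript of
    zero steps is \<open>[]\<close>, so \<open>undefined\<close> stands for any instance.\<close>
  have "sum weight ((\<lambda>i. transcript c xs L i 0) ` Y) \<le> sum weight {transcript c xs L undefined 0}"
    by (rule sum_mono2) (auto simp: weight_nonneg)
  then show ?case by (simp add: weight_def cost_def)
next
  case (Suc n)
  define E where "E tr = (if rounds_done tr < length xs then {tr @ [(L tr, True)], tr @ [(L tr, False)]}
    else {tr})" for tr
  let ?D = "\<lambda>n. (\<lambda>i. transcript c xs L i n) ` Y"
  have E: "finite (E tr)" "sum weight (E tr) \<le> weight tr" for tr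
    using weight_children[of tr "L tr"] by (auto simp: E_def)
  have "transcript c xs L i (Suc n) \<in> E (transcript c xs L i n)" for i
    by (auto simp: E_def Let_def)
  then have "?D (Suc n) \<subseteq> (\<Union>tr\<in>?D n. E tr)" by blast
  then have "sum weight (?D (Suc n)) \<le> sum weight (\<Union>tr\<in>?D n. E tr)"
    using assms E(1) by (intro sum_mono2) (auto simp: weight_nonneg)
  also have "\<dots> \<le> (\<Sum>tr\<in>?D n. sum weight (E tr))"
    using assms E(1) by (intro sum_UN_le) (auto simp: weight_nonneg)
  also have "\<dots> \<le> sum weight (?D n)"
    by (rule sum_mono) (rule E(2))
  finally show ?case using Suc by linarith
qed

text \<open>
  The bound \<open>a + 1 \<le> x + 2\<^sup>a 2\<^sup>-\<^sup>x\<close> for natural numbers \<open>x\<close> linearises the Kraft inequality. Transcripts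
  that are unfinished after \<open>a + 1 + T\<close> steps already contain more than \<open>a\<close> calls.
\<close>

lemma sum_cost_ge:
  assumes Y: "finite Y" "\<And>i j. i \<in> Y \<Longrightarrow> j \<in> Y \<Longrightarrow> \<forall>x\<in>set xs. label i x = label j x \<Longrightarrow> i = j"
    and a: "2 ^ a * (3 / 2) ^ length xs \<le> real (card Y)"
  shows "real (card Y * a) \<le> (\<Sum>i\<in>Y. real (cost (transcript c xs L i (a + 1 + length xs))))"
proof -
  define N where "N = a + 1 + length xs"
  define tr where "tr i = transcript c xs L i N" for i
  define Z where "Z = {i \<in> Y. rounds_done (tr i) = length xs}"
  have Z: "finite Z" "Z \<subseteq> Y" using Y(1) by (auto simp: Z_def)
  have inj: "inj_on tr Z"
  proof (rule inj_onI)
    fix i j assume ij: "i \<in> Z" "j \<in> Z" "tr i = tr j"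
    then have "map (label i) xs = map (label j) xs"
      using transcript_labels[of c xs L i N] transcript_labels[of c xs L j N]
      by (auto simp: Z_def tr_def)
    then show "i = j" using Y(2)[of i j] ij by (auto simp: Z_def)
  qed
  \<comment> \<open>Finished transcripts contain exactly \<open>T\<close> predictions, so the factor
    \<open>(2/3) ^ T\<close> is common to all of them.\<close>
  have "(2 / 3) ^ length xs * (\<Sum>i\<in>Z. (1 / 2) ^ cost (tr i)) = (\<Sum>i\<in>Z. weight (tr i))"
    unfolding sum_distrib_left by (rule sum.cong) (auto simp: Z_def weight_def)
  also have "\<dots> = sum weight (tr ` Z)" by (simp add: sum.reindex[OF inj])
  also have "\<dots> \<le> 1" unfolding tr_def by (rule kraft[OF Z(1)])
  finally have K: "(\<Sum>i\<in>Z. (1 / 2) ^ cost (tr i)) \<le> (3 / 2 :: real) ^ length xs"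
    by (simp add: power_divide field_simps)
  have point: "real a + 1 \<le> real (cost (tr i)) + 2 ^ a * (if i \<in> Z then (1 / 2) ^ cost (tr i) else 0)"
    if "i \<in> Y" for i
  proof (cases "i \<in> Z")
    case True
    show ?thesis
    proof (cases "cost (tr i) \<le> a")
      case le: True
      have "a - cost (tr i) + 1 \<le> (2 ^ (a - cost (tr i)) :: nat)"
        using less_exp[of "a - cost (tr i)"] by linarith
      then have "real (a - cost (tr i) + 1) \<le> 2 ^ (a - cost (tr i))"
        by (metis of_nat_le_iff of_nat_numeral of_nat_power)
      also have "\<dots> = 2 ^ a * (1 / 2) ^ cost (tr i)"
        using le by (simp add: power_diff power_divide)
      finally show ?thesis using True le by simp
    next
      case False
      then have "real a + 1 \<le> real (cost (tr i))" by linarith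
      then show ?thesis using True by (simp add: add_increasing2)
    qed
  next
    case False
    then have "rounds_done (tr i) < length xs"
      using rounds_done_transcript_le[of c xs L i N] that by (auto simp: Z_def tr_def)
    then have "num_calls (tr i) \<ge> a + 1"
      using length_transcript[of "tr i"] length_transcript_unfinished[of c xs L i N]
      by (auto simp: tr_def N_def)
    then show ?thesis using False by (simp add: cost_def)
  qed
  have "real (card Y) * (real a + 1) = (\<Sum>i\<in>Y. real a + 1)" by simp
  also have "\<dots> \<le> (\<Sum>i\<in>Y. real (cost (tr i)) + 2 ^ a * (if i \<in> Z then (1 / 2) ^ cost (tr i) else 0))"
    by (rule sum_mono) (rule point)
  also have "\<dots> = (\<Sum>i\<in>Y. real (cost (tr i))) + 2 ^ a * (\<Sum>i\<in>Z. (1 / 2) ^ cost (tr i))"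
  proof -
    have "(\<Sum>i\<in>Y. if i \<in> Z then (1 / 2 :: real) ^ cost (tr i) else 0) = (\<Sum>i\<in>Z. (1 / 2) ^ cost (tr i))"
      using Z Y(1) by (simp add: sum.If_cases Int_absorb1)
    then show ?thesis by (simp add: sum.distrib flip: sum_distrib_left)
  qed
  also have "\<dots> \<le> (\<Sum>i\<in>Y. real (cost (tr i))) + 2 ^ a * (3 / 2) ^ length xs"
    using K by simp
  \<comment> \<open>The error term averages to at most 1 per instance, which the extra unit in
    \<open>a + 1\<close> pays for.\<close>
  also have "\<dots> \<le> (\<Sum>i\<in>Y. real (cost (tr i))) + real (card Y)" using a by simp
  finally show ?thesis by (simp add: tr_def N_def algebra_simps)
qed

lemma exists_instance_labels:
  assumes S: "setting c xs" and A: "A \<subseteq> set xs" "A \<noteq> {}"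
  shows "\<exists>i\<in>instances c xs. \<forall>x\<in>set xs. label i x \<longleftrightarrow> x \<in> A"
proof -
  let ?X = "points c xs"
  obtain g :: "'a \<Rightarrow> nat" and N where g: "g ` ?X = {i. i < N}" "inj_on g ?X"
    using finite_imp_inj_to_nat_seg[OF finite_points[of c xs]] by metis
  \<comment> \<open>Three layers: the sentinel, if present, then \<open>A\<close>, then the other
    announced points; \<open>g\<close> breaks ties within a layer. The last element of
    \<open>A\<close> serves as \<open>z\<close>.\<close>
  define f where "f x = (if x \<in> A then N + g x else if x \<in> set xs then 2 * N + g x else g x)" for x
  have gN: "g x < N" if "x \<in> ?X" for x using g(1) that by blast
  have "inj_on f ?X"
  proof (rule inj_onI)
    fix x y assume "x \<in> ?X" "y \<in> ?X" "f x = f y"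
    then have "g x = g y" using gN[of x] gN[of y] A(1) by (auto simp: f_def split: if_splits)
    then show "x = y" using g(2) \<open>x \<in> ?X\<close> \<open>y \<in> ?X\<close> by (auto dest: inj_onD)
  qed
  define r where "r = {(x, y). x \<in> ?X \<and> y \<in> ?X \<and> f x \<le> f y}"
  have lin: "linear_order_on ?X r"
    unfolding linear_order_on_def partial_order_on_def preorder_on_def
  proof (intro conjI)
    show "r \<subseteq> ?X \<times> ?X" "refl_on ?X r" "trans r" "total_on ?X r"
      by (auto simp: r_def refl_on_def trans_def total_on_def)
    show "antisym r"
      using \<open>inj_on f ?X\<close> by (auto simp: r_def antisym_def inj_on_def)
  qed
  have fin: "finite A" using A finite_subset by auto
  have "Max (f ` A) \<in> f ` A" using fin A by (intro Max_in) auto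
  then obtain z where z: "z \<in> A" "f z = Max (f ` A)" by auto
  have AX: "A \<subseteq> ?X" using A(1) set_subset_points by (rule subset_trans)
  then have zX: "z \<in> ?X" using z(1) by blast
  have "admissible c xs r"
  proof (cases c)
    case (Conv_E s)
    have "s \<notin> set xs" "s \<in> ?X" using S Conv_E by auto
    moreover have "x = s \<or> x \<in> set xs" if "x \<in> ?X" for x using that Conv_E by auto
    ultimately have "f s \<le> f x" if "x \<in> ?X" for x
      using gN[of s] A(1) that by (fastforce simp: f_def)
    then have "\<forall>x\<in>?X. (s, x) \<in> r" using \<open>s \<in> ?X\<close> by (auto simp: r_def)
    then show ?thesis using lin unfolding Conv_E admissible.simps by blast
  next
    case Conv_N
    then show ?thesis using lin by simp
  qed
  then have "(r, z) \<in> instances c xs" using zX by (simp add: instances_def)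
  moreover have "label (r, z) x \<longleftrightarrow> x \<in> A" if x: "x \<in> set xs" for x
  proof
    have xX: "x \<in> ?X" using subsetD[OF set_subset_points x] .
    assume "label (r, z) x"
    then have "f x \<le> f z" by (simp add: label_iff r_def)
    then show "x \<in> A" using z(1) gN[OF zX] x by (auto simp: f_def split: if_splits)
  next
    assume "x \<in> A"
    then have "f x \<le> f z" using fin z(2) by simp
    then show "label (r, z) x" using \<open>x \<in> A\<close> AX zX by (auto simp: label_iff r_def)
  qed
  ultimately show ?thesis by blast
qed

text \<open>The first point is always labelled 1, so the positive set is nonempty and contains a
  possible \<open>z\<close> under both conventions. This costs one bit, hence the exponent
  \<open>length xs - 1\<close>.\<close>

lemma exists_hard_family:
  assumes S: "setting c xs"
  obtains Y where "Y \<subseteq> instances c xs" "finite Y" "card Y = 2 ^ (length xs - 1)"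
    "\<And>i j. i \<in> Y \<Longrightarrow> j \<in> Y \<Longrightarrow> \<forall>x\<in>set xs. label i x = label j x \<Longrightarrow> i = j"
proof -
  have xs: "xs \<noteq> []" "distinct xs" using S by (cases c; auto)+
  obtain h ys where hys: "xs = h # ys" using xs(1) by (cases xs) auto
  have h: "h \<notin> set ys" "card (set ys) = length xs - 1"
    using xs(2) hys by (auto simp: distinct_card)
  have "\<forall>A\<in>Pow (set ys). \<exists>i. i \<in> instances c xs \<and> (\<forall>x\<in>set xs. label i x \<longleftrightarrow> x \<in> insert h A)"
  proof
    fix A assume "A \<in> Pow (set ys)"
    then have "insert h A \<subseteq> set xs" using hys by auto
    from exists_instance_labels[OF S this]
    show "\<exists>i. i \<in> instances c xs \<and> (\<forall>x\<in>set xs. label i x \<longleftrightarrow> x \<in> insert h A)" by blast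
  qed
  then obtain F where F: "\<And>A. A \<subseteq> set ys \<Longrightarrow> F A \<in> instances c xs \<and>
      (\<forall>x\<in>set xs. label (F A) x \<longleftrightarrow> x \<in> insert h A)"
    by (metis Pow_iff)
  have eq: "A = B" if "A \<subseteq> set ys" "B \<subseteq> set ys"
    "\<forall>x\<in>set xs. label (F A) x = label (F B) x" for A B
    using F[OF that(1)] F[OF that(2)] that h(1) hys by auto
  have "inj_on F (Pow (set ys))"
    by (rule inj_onI) (use eq in auto)
  then have "card (F ` Pow (set ys)) = 2 ^ (length xs - 1)"
    using h(2) by (simp add: card_image card_Pow)
  moreover have "i = j" if "i \<in> F ` Pow (set ys)" "j \<in> F ` Pow (set ys)"
    "\<forall>x\<in>set xs. label i x = label j x" for i j
    using that eq by auto
  ultimately show ?thesis using F by (intro that[of "F ` Pow (set ys)"]) auto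
qed

text \<open>Five rounds contribute \<open>2 * (3/2)^5 = 243/16 < 16\<close> on the left and 32 on
  the right. The factor 2 gained in one group of five pays for the lost bit.\<close>

lemma power_five_bound:
  assumes "T \<ge> 5"
  shows "2 ^ (T div 5) * (3 / 2) ^ T \<le> (2 :: real) ^ (T - 1)"
proof -
  define b where "b = T div 5"
  define r where "r = T mod 5"
  have T: "T = 5 * b + r" "b \<ge> 1" using assms by (auto simp: b_def r_def)
  have "(3 / 2 :: real) ^ 5 = 243 / 32" by (simp add: power_divide)
  then have "(3 / 2 :: real) ^ T = (243 / 32) ^ b * (3 / 2) ^ r"
    unfolding T(1) by (simp only: power_add power_mult)
  moreover have "(2 :: real) ^ b * (243 / 32) ^ b = (243 / 16) ^ b"
    by (simp only: power_mult_distrib[symmetric]) simp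
  ultimately have "2 * (2 ^ b * (3 / 2) ^ T) = 2 * (243 / 16) ^ b * (3 / 2 :: real) ^ r"
    by simp
  also have "\<dots> \<le> 2 * (16 ^ b) * 2 ^ r"
    by (intro mult_mono power_mono) auto
  also have "2 * (16 :: real) ^ b \<le> 32 ^ b"
  proof -
    have "(2 :: real) ^ 1 \<le> 2 ^ b" by (rule power_increasing) (use T in auto)
    then have "2 * (16 :: real) ^ b \<le> 2 ^ b * 16 ^ b" by (intro mult_right_mono) auto
    then show ?thesis by (simp add: power_mult_distrib[symmetric])
  qed
  also have "32 ^ b * 2 ^ r = (2 :: real) ^ T"
    unfolding T(1) by (simp add: power_add power_mult)
  also have "(2 :: real) ^ T = 2 * 2 ^ (T - 1)"
    using assms by (cases T) auto
  finally show ?thesis unfolding b_def by simp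
qed

section \<open>Randomized learners: measurability and averaging\<close>

lemma cost_le: "of_nat (cost (transcript c xs L i n)) \<le>
    ennreal_of_enat (calls c xs L i) + ennreal_of_enat (mistakes c xs L i)"
proof -
  have "enat (num_calls (transcript c xs L i n)) \<le> calls c xs L i"
    unfolding calls_def num_calls_def by (rule SUP_upper) simp
  moreover have "enat (num_mistakes (transcript c xs L i n)) \<le> mistakes c xs L i"
    unfolding mistakes_def num_mistakes_def by (rule SUP_upper) simp
  ultimately have "enat (cost (transcript c xs L i n)) \<le> calls c xs L i + mistakes c xs L i"
    unfolding cost_def plus_enat_simps(1)[symmetric] by (rule add_mono)
  then have "ennreal_of_enat (enat (cost (transcript c xs L i n))) \<le>
      ennreal_of_enat (calls c xs L i + mistakes c xs L i)"
    by (simp only: ennreal_of_enat_le_iff)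
  then show ?thesis by simp
qed

definition legal_actions :: "'a convention \<Rightarrow> 'a list \<Rightarrow> 'a action set" where
  "legal_actions c xs = Call ` Pow (points c xs \<times> UNIV) \<union> range Predict"

lemma finite_legal_actions: "finite (legal_actions c xs)"
  by (simp add: legal_actions_def)

lemma legal_learner_actions: "legal_learner c xs L \<Longrightarrow> L tr \<in> legal_actions c xs"
  by (cases "L tr") (auto simp: legal_learner_def legal_actions_def)

text \<open>There may be uncountably many actions, but a legal learner only uses finitely many.\<close>

lemma measurable_transcript:
  assumes L: "randomized_learner c xs M L"
  shows "(\<lambda>\<omega>. transcript c xs (L \<omega>) i n) \<in> M \<rightarrow>\<^sub>M count_space UNIV"
proof (induction n)
  case 0
  then show ?case by simp
next
  case (Suc n)
  let ?I = "lists (legal_actions c xs \<times> (UNIV :: bool set))"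
  have countable: "countable ?I"
    by (intro countable_lists countable_finite) (simp add: finite_legal_actions)
  have in_I: "transcript c xs (L \<omega>) i k \<in> ?I" if "\<omega> \<in> space M" for \<omega> k
    using legal_learner_actions[of c xs "L \<omega>"] L that
    by (induction k) (auto simp: Let_def randomized_learner_def)
  have "(\<lambda>\<omega>. transcript c xs (L \<omega>) i n) \<in> M \<rightarrow>\<^sub>M count_space ?I"
    using in_I by (intro measurable_count_space_extend[OF subset_UNIV _ Suc]) blast
  moreover have "(\<lambda>\<omega>. if rounds_done tr < length xs then tr @ [(L \<omega> tr, answer c xs i tr (L \<omega> tr))] else tr)
      \<in> M \<rightarrow>\<^sub>M count_space UNIV" for tr
  proof -
    have "(\<lambda>\<omega>. L \<omega> tr) \<in> M \<rightarrow>\<^sub>M count_space UNIV"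
      using L by (simp add: randomized_learner_def)
    then show ?thesis
      by (rule measurable_compose[of _ _ _
          "\<lambda>a. if rounds_done tr < length xs then tr @ [(a, answer c xs i tr a)] else tr"]) simp
  qed
  \<comment> \<open>For a fixed earlier transcript the next step is measurable in the randomness;
    only countably many transcripts occur, so the pieces combine.\<close>
  ultimately show ?case
    unfolding transcript_Suc Let_def by (rule measurable_compose_countable'[OF _ _ countable, rotated])
qed

lemma measurable_calls_mistakes:
  assumes "randomized_learner c xs M L"
  shows "(\<lambda>\<omega>. ennreal_of_enat (calls c xs (L \<omega>) i)) \<in> borel_measurable M"
    and "(\<lambda>\<omega>. ennreal_of_enat (mistakes c xs (L \<omega>) i)) \<in> borel_measurable M"
proof -
  have "(\<lambda>\<omega>. ennreal_of_enat (enat (length (filter P (transcript c xs (L \<omega>) i n))))) \<in> borel_measurable M"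
    for P n
    by (rule measurable_compose[OF measurable_transcript[OF assms]]) simp
  then show "(\<lambda>\<omega>. ennreal_of_enat (calls c xs (L \<omega>) i)) \<in> borel_measurable M"
    and "(\<lambda>\<omega>. ennreal_of_enat (mistakes c xs (L \<omega>) i)) \<in> borel_measurable M"
    unfolding calls_def mistakes_def ennreal_of_enat_Sup image_image
    by (intro borel_measurable_SUP; simp)+
qed

lemma eps_bounds: "0 \<le> eps c" "eps c \<le> 1"
  by (cases c; simp)+

text \<open>Averaging in the manner of Yao: the bound on the sum over \<open>Y\<close> holds for
  each outcome of the randomness, hence in expectation, and some member of \<open>Y\<close> reaches
  the average. Both expectations refer to the same instance, so a cap on calls turns into a bound on
  mistakes there.\<close>

lemma calls_plus_mistakes_lower_bound:
  assumes S: "setting c xs" and T: "real (length xs) - eps c \<ge> 100"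
    and L: "randomized_learner c xs M L"
  shows "\<exists>i\<in>instances c xs. ennreal ((real (length xs) - eps c) / 10) \<le>
    expected_calls c xs M L i + expected_mistakes c xs M L i"
proof -
  interpret prob_space M using L by (simp add: randomized_learner_def)
  define a where "a = length xs div 5"
  have T': "length xs \<ge> 100" using T eps_bounds(1)[of c] by linarith
  have "real (length xs) \<le> 5 * real a + 4" unfolding a_def by linarith
  then have a: "(real (length xs) - eps c) / 10 \<le> real a" "a > 0"
    using T' eps_bounds(1)[of c] by auto
  obtain Y where Y: "Y \<subseteq> instances c xs" "finite Y" "card Y = 2 ^ (length xs - 1)"
    "\<And>i j. i \<in> Y \<Longrightarrow> j \<in> Y \<Longrightarrow> \<forall>x\<in>set xs. label i x = label j x \<Longrightarrow> i = j"
    using exists_hard_family[OF S] by blast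
  have Yne: "Y \<noteq> {}" using Y(3) by force
  define e where "e i = expected_calls c xs M L i + expected_mistakes c xs M L i" for i
  define f where "f i \<omega> = ennreal_of_enat (calls c xs (L \<omega>) i) + ennreal_of_enat (mistakes c xs (L \<omega>) i)"
    for i \<omega>
  note meas = measurable_calls_mistakes[OF L]
  have f_meas: "f i \<in> borel_measurable M" for i
    unfolding f_def using meas by simp
  have e: "e i = (\<integral>\<^sup>+ \<omega>. f i \<omega> \<partial>M)" for i
    unfolding e_def f_def expected_calls_def expected_mistakes_def
    using meas by (simp add: nn_integral_add)
  have point: "of_nat (card Y * a) \<le> (\<Sum>i\<in>Y. f i \<omega>)" for \<omega>
  proof -
    let ?n = "a + 1 + length xs"
    have "2 ^ a * (3 / 2) ^ length xs \<le> real (card Y)"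
      using power_five_bound[of "length xs"] T' Y(3) by (simp add: a_def)
    then have "real (card Y * a) \<le> (\<Sum>i\<in>Y. real (cost (transcript c xs (L \<omega>) i ?n)))"
      using sum_cost_ge[OF Y(2,4)] by blast
    then have "card Y * a \<le> (\<Sum>i\<in>Y. cost (transcript c xs (L \<omega>) i ?n))"
      by (simp only: of_nat_sum[symmetric] of_nat_le_iff)
    then have "(of_nat (card Y * a) :: ennreal) \<le> (\<Sum>i\<in>Y. of_nat (cost (transcript c xs (L \<omega>) i ?n)))"
      by (simp only: of_nat_sum[symmetric] of_nat_le_iff)
    also have "\<dots> \<le> (\<Sum>i\<in>Y. f i \<omega>)" unfolding f_def by (intro sum_mono cost_le)
    finally show ?thesis .
  qed
  have "of_nat (card Y * a) = (\<integral>\<^sup>+ \<omega>. of_nat (card Y * a) \<partial>M)"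
    by (simp add: emeasure_space_1)
  also have "\<dots> \<le> (\<integral>\<^sup>+ \<omega>. (\<Sum>i\<in>Y. f i \<omega>) \<partial>M)" by (rule nn_integral_mono) (rule point)
  also have "\<dots> = (\<Sum>i\<in>Y. e i)" using f_meas by (simp add: nn_integral_sum e)
  finally have sum: "of_nat (card Y * a) \<le> (\<Sum>i\<in>Y. e i)" .
  have "Max (e ` Y) \<in> e ` Y" using Y(2) Yne by (intro Max_in) auto
  then obtain i where i: "i \<in> Y" "e i = Max (e ` Y)" by auto
  have "(\<Sum>i\<in>Y. e i) \<le> of_nat (card Y) * e i"
    using Y(2) i(2) by (intro sum_bounded_above) simp
  with sum have "of_nat (card Y) * of_nat a \<le> of_nat (card Y) * e i"
    by (metis of_nat_mult order_trans)
  then have "of_nat a \<le> e i"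
    using Yne Y(2) by (subst (asm) ennreal_mult_le_mult_iff) auto
  moreover have "ennreal ((real (length xs) - eps c) / 10) \<le> of_nat a"
    using a(1) by (simp add: ennreal_of_nat_eq_real_of_nat ennreal_leI)
  ultimately show ?thesis using i(1) Y(1) unfolding e_def by (meson order_trans subsetD)
qed

lemma worst_lower_bound:
  assumes S: "setting c xs" and T: "real (length xs) - eps c \<ge> 100"
    and L: "randomized_learner c xs M L"
  shows "ennreal ((real (length xs) - eps c) / 10) \<le>
    worst_expected_calls c xs M L + worst_expected_mistakes c xs M L"
proof -
  obtain i where i: "i \<in> instances c xs" "ennreal ((real (length xs) - eps c) / 10) \<le>
    expected_calls c xs M L i + expected_mistakes c xs M L i"
    using calls_plus_mistakes_lower_bound[OF assms] by blast
  note i(2)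
  also have "expected_calls c xs M L i + expected_mistakes c xs M L i \<le>
      worst_expected_calls c xs M L + worst_expected_mistakes c xs M L"
    unfolding worst_expected_calls_def worst_expected_mistakes_def
    using i(1) by (intro add_mono SUP_upper)
  finally show ?thesis .
qed

section \<open>Deterministic learners as constant ones, and the asymptotic consequences\<close>

lemma randomized_const:
  assumes "prob_space M" "legal_learner c xs L"
  shows "randomized_learner c xs M (\<lambda>_. L)"
    "worst_expected_calls c xs M (\<lambda>_. L) = worst_calls c xs L"
    "worst_expected_mistakes c xs M (\<lambda>_. L) = worst_mistakes c xs L"
  using assms prob_space.emeasure_space_1[OF assms(1)]
  by (simp_all add: randomized_learner_def worst_expected_calls_def worst_calls_def
      worst_expected_mistakes_def worst_mistakes_def expected_calls_def expected_mistakes_def)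

lemma exists_prob_space: "\<exists>M :: 'w measure. prob_space M"
  by (intro exI[of _ "return (count_space UNIV) undefined"] prob_space_return) simp

text \<open>From \<open>T >= 2\<close> on, \<open>T + 1 <= T ^ 2\<close>, so
  \<open>log 2 (T + 1)\<close> is at most twice \<open>log 2 T\<close>; at \<open>T = 1\<close> the
  latter vanishes.\<close>

lemma log_learner:
  fixes c :: "'a convention"
  assumes S: "setting c xs" and T: "length xs \<ge> 2"
  obtains L where "legal_learner c xs L"
    "worst_calls c xs L \<le> ennreal (66 * real (length xs))"
    "worst_mistakes c xs L \<le> ennreal (2 * log 2 (real (length xs)))"
proof -
  let ?n = "card (points c xs)"
  have n: "?n \<le> length xs + 1" "?n > 0" "points c xs \<noteq> {}"
  proof -
    show "?n \<le> length xs + 1" using card_length[of xs] by (cases c) (auto simp: card_insert_if)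
    show "points c xs \<noteq> {}" using T by (cases c) auto
    then show "?n > 0" by (simp add: card_gt_0_iff)
  qed
  obtain L where L: "legal_learner c xs L"
    "\<forall>i\<in>instances c xs. calls c xs L i \<le> enat (66 * (?n - 1)) \<and>
       mistakes c xs L i \<le> enat (nat \<lfloor>log 2 (real ?n)\<rfloor>)"
    using halving_learner[OF n(3)] by blast
  have "real ?n \<le> real (length xs + 1)" using n(1) by (simp only: of_nat_le_iff)
  also have "\<dots> \<le> real (length xs) ^ 2"
  proof -
    have "2 * real (length xs) \<le> real (length xs) * real (length xs)"
      using T by (intro mult_right_mono) auto
    then show ?thesis using T unfolding power2_eq_square by simp
  qed
  finally have "log 2 (real ?n) \<le> log 2 (real (length xs) ^ 2)"
    using n(2) T by (subst log_le_cancel_iff) auto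
  also have "\<dots> = 2 * log 2 (real (length xs))" using T by (simp add: log_nat_power)
  finally have log: "log 2 (real ?n) \<le> 2 * log 2 (real (length xs))" .
  have "0 \<le> log 2 (real ?n)" using n(2) by simp
  with log have "real (nat \<lfloor>log 2 (real ?n)\<rfloor>) \<le> 2 * log 2 (real (length xs))" by linarith
  moreover have "real (66 * (?n - 1)) \<le> 66 * real (length xs)" using n(1) by simp
  ultimately have bounds: "ennreal_of_enat (enat (66 * (?n - 1))) \<le> ennreal (66 * real (length xs))"
    "ennreal_of_enat (enat (nat \<lfloor>log 2 (real ?n)\<rfloor>)) \<le> ennreal (2 * log 2 (real (length xs)))"
    unfolding ennreal_of_enat_enat ennreal_of_nat_eq_real_of_nat by (simp_all only: ennreal_leI)
  show ?thesis
  proof (rule that[OF L(1)])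
    show "worst_calls c xs L \<le> ennreal (66 * real (length xs))"
      unfolding worst_calls_def
      using L(2) by (intro SUP_least order_trans[OF _ bounds(1)]) (simp only: ennreal_of_enat_le_iff)
    show "worst_mistakes c xs L \<le> ennreal (2 * log 2 (real (length xs)))"
      unfolding worst_mistakes_def
      using L(2) by (intro SUP_least order_trans[OF _ bounds(2)]) (simp only: ennreal_of_enat_le_iff)
  qed
qed

lemma log_eventually_small:
  fixes K :: real
  obtains T0 :: nat where "T0 \<ge> 101"
    "\<And>T. T \<ge> T0 \<Longrightarrow> \<bar>K\<bar> * log 2 (real T) + real T / 20 \<le> (real T - 1) / 10"
proof -
  \<comment> \<open>Chosen so that the logarithmic term is at most \<open>T / 100\<close>; the
    \<open>+ 1\<close> keeps the denominator positive for \<open>K = 0\<close>.\<close>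
  define \<delta> where "\<delta> = ln 2 / (100 * (\<bar>K\<bar> + 1))"
  have "\<delta> > 0" by (simp add: \<delta>_def)
  then have "eventually (\<lambda>x::real. ln x / x < \<delta>) at_top"
    using order_tendstoD(2)[OF ln_x_over_x_tendsto_0] by blast
  then obtain N where N: "\<And>x::real. x \<ge> N \<Longrightarrow> ln x / x < \<delta>"
    by (auto simp: eventually_at_top_linorder)
  show ?thesis
  proof (rule that[of "max 101 (nat \<lceil>N\<rceil>)"])
    fix T :: nat assume T: "T \<ge> max 101 (nat \<lceil>N\<rceil>)"
    then have "real T \<ge> N" "real T \<ge> 101" by linarith+
    then have "ln (real T) \<le> \<delta> * real T" using N[of "real T"] by (simp add: field_simps)
    then have "log 2 (real T) \<le> real T / (100 * (\<bar>K\<bar> + 1))"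
      by (simp add: log_def \<delta>_def field_simps)
    then have "\<bar>K\<bar> * log 2 (real T) \<le> \<bar>K\<bar> * (real T / (100 * (\<bar>K\<bar> + 1)))"
      by (intro mult_left_mono) auto
    also have "\<dots> \<le> real T / 100" by (simp add: field_simps)
    finally have "\<bar>K\<bar> * log 2 (real T) + real T / 20 \<le> real T / 100 + real T / 20"
      by (rule add_right_mono)
    also have "\<dots> \<le> (real T - 1) / 10" using \<open>real T \<ge> 101\<close> by simp
    finally show "\<bar>K\<bar> * log 2 (real T) + real T / 20 \<le> (real T - 1) / 10" .
  qed simp
qed

text \<open>Calls and mistakes together reach about \<open>T / 10\<close>, and logarithmically many
  mistakes cover less than half of this.\<close>

lemma linear_calls_necessary:
  assumes S: "setting c xs" and T: "length xs \<ge> 101"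
    and K: "\<bar>K\<bar> * log 2 (real (length xs)) + real (length xs) / 20 \<le> (real (length xs) - 1) / 10"
    and L: "randomized_learner c xs M L"
    and m: "worst_expected_mistakes c xs M L \<le> ennreal (K * log 2 (real (length xs)))"
  shows "ennreal (1 / 20 * real (length xs)) \<le> worst_expected_calls c xs M L"
proof (cases "worst_expected_calls c xs M L")
  case (real q)
  define l where "l = log 2 (real (length xs))"
  define k where "k = \<bar>K\<bar> * l"
  have "l \<ge> 0" using T unfolding l_def by (subst zero_le_log_cancel_iff) auto
  then have k: "K * l \<le> k" "k \<ge> 0" by (auto simp: k_def intro: mult_right_mono)
  have "real (length xs) - eps c \<ge> 100" using T eps_bounds[of c] by linarith
  from worst_lower_bound[OF S this L]
  have "ennreal ((real (length xs) - eps c) / 10) \<le> ennreal q + ennreal (K * l)"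
    using m real(2) unfolding l_def by (metis add_left_mono order_trans)
  also have "\<dots> \<le> ennreal q + ennreal k"
    using k(1) by (intro add_left_mono ennreal_leI)
  also have "\<dots> = ennreal (q + k)"
    using real(1) k(2) by (simp add: ennreal_plus)
  finally have "(real (length xs) - eps c) / 10 \<le> q + k"
    using real(1) k(2) by (subst (asm) ennreal_le_iff) auto
  moreover have "k + real (length xs) / 20 \<le> (real (length xs) - 1) / 10"
    using K unfolding k_def l_def .
  ultimately have "1 / 20 * real (length xs) \<le> q" using eps_bounds(2)[of c] by argo
  then show ?thesis unfolding real(2) by (rule ennreal_leI)
qed simp

theorem theorem7p2:
  shows
  "(\<forall>(s :: 'a) xs. setting (Conv_E s) xs \<longrightarrow>
      (\<exists>L. legal_learner (Conv_E s) xs L \<and>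
        (\<forall>i\<in>instances (Conv_E s) xs.
           calls (Conv_E s) xs L i \<le> enat (66 * length xs) \<and>
           mistakes (Conv_E s) xs L i \<le> enat (nat \<lfloor>log 2 (real (length xs) + 1)\<rfloor>)))) \<and>
   (\<forall>xs :: 'a list. setting Conv_N xs \<longrightarrow>
      (\<exists>L. legal_learner Conv_N xs L \<and>
        (\<forall>i\<in>instances Conv_N xs.
           calls Conv_N xs L i \<le> enat (67 * (length xs - 1)) \<and>
           mistakes Conv_N xs L i \<le> enat (nat \<lfloor>log 2 (real (length xs))\<rfloor>)))) \<and>

   (\<forall>(c :: 'a convention) xs (M :: 'w measure) L.
      setting c xs \<and> real (length xs) - eps c \<ge> 100 \<and> randomized_learner c xs M L \<and>
      (\<forall>\<omega>\<in>space M. \<forall>i\<in>instances c xs.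
         ennreal_of_enat (calls c xs (L \<omega>) i) \<le> ennreal ((real (length xs) - eps c) / 20)) \<longrightarrow>
      (\<exists>i\<in>instances c xs.
         expected_mistakes c xs M L i \<ge> ennreal ((real (length xs) - eps c) / 20))) \<and>
   (\<forall>(c :: 'a convention) xs (M :: 'w measure) L.
      setting c xs \<and> real (length xs) - eps c \<ge> 100 \<and> randomized_learner c xs M L \<longrightarrow>
      worst_expected_mistakes c xs M L + 20 * worst_expected_calls c xs M L
        \<ge> ennreal ((real (length xs) - eps c) / 20)) \<and>

   (\<exists>C K :: real. \<forall>(c :: 'a convention) xs. setting c xs \<and> length xs \<ge> 2 \<longrightarrow>
      (\<exists>L. legal_learner c xs L \<and>
         worst_calls c xs L \<le> ennreal (C * real (length xs)) \<and>
         worst_mistakes c xs L \<le> ennreal (K * log 2 (real (length xs)))) \<and>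
      (\<exists>(M :: 'w measure) L. randomized_learner c xs M L \<and>
         worst_expected_calls c xs M L \<le> ennreal (C * real (length xs)) \<and>
         worst_expected_mistakes c xs M L \<le> ennreal (K * log 2 (real (length xs))))) \<and>
   (\<forall>K :: real. \<exists>d > 0. \<exists>T0 :: nat. \<forall>(c :: 'a convention) xs.
      setting c xs \<and> length xs \<ge> T0 \<longrightarrow>
      (\<forall>L. legal_learner c xs L \<and>
         worst_mistakes c xs L \<le> ennreal (K * log 2 (real (length xs))) \<longrightarrow>
         worst_calls c xs L \<ge> ennreal (d * real (length xs))) \<and>
      (\<forall>(M :: 'w measure) L. randomized_learner c xs M L \<and>
         worst_expected_mistakes c xs M L \<le> ennreal (K * log 2 (real (length xs))) \<longrightarrow>
         worst_expected_calls c xs M L \<ge> ennreal (d * real (length xs))))"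
proof (intro conjI)
  show "\<forall>(s :: 'a) xs. setting (Conv_E s) xs \<longrightarrow>
      (\<exists>L. legal_learner (Conv_E s) xs L \<and>
        (\<forall>i\<in>instances (Conv_E s) xs.
           calls (Conv_E s) xs L i \<le> enat (66 * length xs) \<and>
           mistakes (Conv_E s) xs L i \<le> enat (nat \<lfloor>log 2 (real (length xs) + 1)\<rfloor>)))"
  proof (intro allI impI)
    fix s :: 'a and xs assume S: "setting (Conv_E s) xs"
    then have n: "card (points (Conv_E s) xs) = length xs + 1"
      by (simp add: distinct_card)
    have "points (Conv_E s) xs \<noteq> {}" by simp
    from halving_learner[OF this] obtain L where L: "legal_learner (Conv_E s) xs L"
      "\<forall>i\<in>instances (Conv_E s) xs.
        calls (Conv_E s) xs L i \<le> enat (66 * (card (points (Conv_E s) xs) - 1)) \<and>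
        mistakes (Conv_E s) xs L i \<le> enat (nat \<lfloor>log 2 (real (card (points (Conv_E s) xs)))\<rfloor>)"
      by blast
    have eq: "real (length xs + 1) = real (length xs) + 1" by simp
    show "\<exists>L. legal_learner (Conv_E s) xs L \<and>
        (\<forall>i\<in>instances (Conv_E s) xs.
           calls (Conv_E s) xs L i \<le> enat (66 * length xs) \<and>
           mistakes (Conv_E s) xs L i \<le> enat (nat \<lfloor>log 2 (real (length xs) + 1)\<rfloor>))"
      using L unfolding n eq add_diff_cancel_right' by blast
  qed
next
  show "\<forall>xs :: 'a list. setting Conv_N xs \<longrightarrow>
      (\<exists>L. legal_learner Conv_N xs L \<and>
        (\<forall>i\<in>instances Conv_N xs.
           calls Conv_N xs L i \<le> enat (67 * (length xs - 1)) \<and>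
           mistakes Conv_N xs L i \<le> enat (nat \<lfloor>log 2 (real (length xs))\<rfloor>)))"
  proof (intro allI impI)
    fix xs :: "'a list" assume S: "setting Conv_N xs"
    then have n: "card (points Conv_N xs) = length xs"
      by (simp add: distinct_card)
    have "points Conv_N xs \<noteq> {}" using S by auto
    from halving_learner[OF this] obtain L where L: "legal_learner Conv_N xs L"
      "\<forall>i\<in>instances Conv_N xs.
        calls Conv_N xs L i \<le> enat (66 * (card (points Conv_N xs) - 1)) \<and>
        mistakes Conv_N xs L i \<le> enat (nat \<lfloor>log 2 (real (card (points Conv_N xs)))\<rfloor>)"
      by blast
    have "enat (66 * (length xs - 1)) \<le> enat (67 * (length xs - 1))" by simp
    then show "\<exists>L. legal_learner Conv_N xs L \<and>
        (\<forall>i\<in>instances Conv_N xs.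
           calls Conv_N xs L i \<le> enat (67 * (length xs - 1)) \<and>
           mistakes Conv_N xs L i \<le> enat (nat \<lfloor>log 2 (real (length xs))\<rfloor>))"
      using L unfolding n by (meson order_trans)
  qed
next
  show "\<forall>(c :: 'a convention) xs (M :: 'w measure) L.
      setting c xs \<and> real (length xs) - eps c \<ge> 100 \<and> randomized_learner c xs M L \<and>
      (\<forall>\<omega>\<in>space M. \<forall>i\<in>instances c xs.
         ennreal_of_enat (calls c xs (L \<omega>) i) \<le> ennreal ((real (length xs) - eps c) / 20)) \<longrightarrow>
      (\<exists>i\<in>instances c xs.
         expected_mistakes c xs M L i \<ge> ennreal ((real (length xs) - eps c) / 20))"
  proof (intro allI impI; elim conjE)
    fix c :: "'a convention" and xs :: "'a list" and M :: "'w measure" and L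
    let ?n = "(real (length xs) - eps c) / 20"
    assume S: "setting c xs" and T: "real (length xs) - eps c \<ge> 100"
      and L: "randomized_learner c xs M L"
      and calls: "\<forall>\<omega>\<in>space M. \<forall>i\<in>instances c xs. ennreal_of_enat (calls c xs (L \<omega>) i) \<le> ennreal ?n"
    interpret prob_space M using L by (simp add: randomized_learner_def)
    obtain i where i: "i \<in> instances c xs" "ennreal ((real (length xs) - eps c) / 10) \<le>
        expected_calls c xs M L i + expected_mistakes c xs M L i"
      using calls_plus_mistakes_lower_bound[OF S T L] by blast
    have "expected_calls c xs M L i \<le> (\<integral>\<^sup>+ \<omega>. ennreal ?n \<partial>M)"
      unfolding expected_calls_def using calls i(1) by (intro nn_integral_mono) blast
    also have "\<dots> = ennreal ?n" by (simp add: emeasure_space_1)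
    finally have "ennreal ((real (length xs) - eps c) / 10) \<le> ennreal ?n + expected_mistakes c xs M L i"
      using i(2) by (meson add_right_mono order_trans)
    \<comment> \<open>The total at this instance is at least twice the call cap, so mistakes make up
      the other half.\<close>
    moreover have "ennreal ((real (length xs) - eps c) / 10) = ennreal ?n + ennreal ?n"
      using T by (simp flip: ennreal_plus)
    ultimately have "ennreal ?n \<le> expected_mistakes c xs M L i"
      by (simp add: ennreal_add_left_cancel_le)
    then show "\<exists>i\<in>instances c xs. expected_mistakes c xs M L i \<ge> ennreal ?n"
      using i(1) by blast
  qed
next
  show "\<forall>(c :: 'a convention) xs (M :: 'w measure) L.
      setting c xs \<and> real (length xs) - eps c \<ge> 100 \<and> randomized_learner c xs M L \<longrightarrow>
      worst_expected_mistakes c xs M L + 20 * worst_expected_calls c xs M L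
        \<ge> ennreal ((real (length xs) - eps c) / 20)"
  proof (intro allI impI; elim conjE)
    fix c :: "'a convention" and xs :: "'a list" and M :: "'w measure" and L
    assume *: "setting c xs" "real (length xs) - eps c \<ge> 100" "randomized_learner c xs M L"
    have "ennreal ((real (length xs) - eps c) / 20) \<le> ennreal ((real (length xs) - eps c) / 10)"
      using *(2) by (intro ennreal_leI) simp
    also have "\<dots> \<le> worst_expected_calls c xs M L + worst_expected_mistakes c xs M L"
      using worst_lower_bound[OF *] .
    also have "\<dots> \<le> worst_expected_mistakes c xs M L + 20 * worst_expected_calls c xs M L"
    proof -
      have "1 * worst_expected_calls c xs M L \<le> 20 * worst_expected_calls c xs M L"
        by (intro mult_right_mono) auto
      then show ?thesis by (simp add: add.commute add_left_mono)
    qed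
    finally show "ennreal ((real (length xs) - eps c) / 20) \<le>
      worst_expected_mistakes c xs M L + 20 * worst_expected_calls c xs M L" .
  qed
next
  obtain M0 :: "'w measure" where M0: "prob_space M0" using exists_prob_space by blast
  show "\<exists>C K :: real. \<forall>(c :: 'a convention) xs. setting c xs \<and> length xs \<ge> 2 \<longrightarrow>
      (\<exists>L. legal_learner c xs L \<and>
         worst_calls c xs L \<le> ennreal (C * real (length xs)) \<and>
         worst_mistakes c xs L \<le> ennreal (K * log 2 (real (length xs)))) \<and>
      (\<exists>(M :: 'w measure) L. randomized_learner c xs M L \<and>
         worst_expected_calls c xs M L \<le> ennreal (C * real (length xs)) \<and>
         worst_expected_mistakes c xs M L \<le> ennreal (K * log 2 (real (length xs))))"
    by (intro exI[of _ "66 :: real"] exI[of _ "2 :: real"] allI impI)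
      (metis log_learner randomized_const[OF M0])
next
  show "\<forall>K :: real. \<exists>d > 0. \<exists>T0 :: nat. \<forall>(c :: 'a convention) xs.
      setting c xs \<and> length xs \<ge> T0 \<longrightarrow>
      (\<forall>L. legal_learner c xs L \<and>
         worst_mistakes c xs L \<le> ennreal (K * log 2 (real (length xs))) \<longrightarrow>
         worst_calls c xs L \<ge> ennreal (d * real (length xs))) \<and>
      (\<forall>(M :: 'w measure) L. randomized_learner c xs M L \<and>
         worst_expected_mistakes c xs M L \<le> ennreal (K * log 2 (real (length xs))) \<longrightarrow>
         worst_expected_calls c xs M L \<ge> ennreal (d * real (length xs)))"
  proof
    fix K :: real
    obtain M0 :: "'w measure" where M0: "prob_space M0" using exists_prob_space by blast
    obtain T0 :: nat where T0: "T0 \<ge> 101"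
      "\<And>T. T \<ge> T0 \<Longrightarrow> \<bar>K\<bar> * log 2 (real T) + real T / 20 \<le> (real T - 1) / 10"
      using log_eventually_small by blast
    have randomized: "ennreal (1 / 20 * real (length xs)) \<le> worst_expected_calls c xs M L"
      if "setting c xs" "length xs \<ge> T0" "randomized_learner c xs M L"
        "worst_expected_mistakes c xs M L \<le> ennreal (K * log 2 (real (length xs)))"
      for c :: "'a convention" and xs :: "'a list" and M :: "'w measure" and L
      using linear_calls_necessary[OF that(1) _ T0(2)[OF that(2)] that(3,4)] that(2) T0(1) by simp
    moreover have "ennreal (1 / 20 * real (length xs)) \<le> worst_calls c xs L"
      if "setting c xs" "length xs \<ge> T0" "legal_learner c xs L"
        "worst_mistakes c xs L \<le> ennreal (K * log 2 (real (length xs)))"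
      for c :: "'a convention" and xs :: "'a list" and L
      using randomized[OF that(1,2) randomized_const(1)[OF M0 that(3)]] that(4)
      by (simp only: randomized_const(2,3)[OF M0 that(3)])
    ultimately show "\<exists>d > 0. \<exists>T0 :: nat. \<forall>(c :: 'a convention) xs.
      setting c xs \<and> length xs \<ge> T0 \<longrightarrow>
      (\<forall>L. legal_learner c xs L \<and>
         worst_mistakes c xs L \<le> ennreal (K * log 2 (real (length xs))) \<longrightarrow>
         worst_calls c xs L \<ge> ennreal (d * real (length xs))) \<and>
      (\<forall>(M :: 'w measure) L. randomized_learner c xs M L \<and>
         worst_expected_mistakes c xs M L \<le> ennreal (K * log 2 (real (length xs))) \<longrightarrow>
         worst_expected_calls c xs M L \<ge> ennreal (d * real (length xs)))"
      by (intro exI[of _ "1 / 20 :: real"] conjI exI[of _ T0]) auto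
  qed
qed

end
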